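(* Let $\mathbb{K}$ be a field with $\operatorname{char}(\mathbb{K})=p>0$, let $R=\mathbb{K}[X_1,\ldots,X_n]$ be the standard graded polynomial ring, $I$ a homogeneous ideal of $R$, and $e\ge 1$ an integer. Let $I^{[p^e]}$ be the $p^e$-th Frobenius power of $I$. If $\beta_{i,j}(R/I^{[p^e]})$ is an extremal Betti number, then $j=p^e l$ for some $l$, and $\beta_{i,l}(R/I)$ is an extremal Betti number. Conversely, if $\beta_{i,j}(R/I)$ is an extremal Betti number, then $\beta_{i,p^e j}(R/I^{[p^e]})$ is an extremal Betti number.
   Context: The $p^e$-th Frobenius power $I^{[p^e]}$ of $I$ is the ideal of $R$ generated by $\{f^{p^e}: f\in I\}$. The graded Betti numbers are $\beta_{i,j}(R/I)=\dim_{\mathbb{K}}\operatorname{Tor}_i^R(\mathbb{K},R/I)_j$. A nonzero graded Betti number $\beta_{i,j}(R/I)$ is called extremal if $\beta_{k,l}(R/I)=0$ for all pairs $(k,l)\neq(i,j)$ with $k\ge i$ and $l\ge j$. *)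

theory Defs
  imports "HOL-Library.Poly_Mapping" Complex_Main
begin

section \<open>The polynomial ring and its ideals\<close>

text \<open>
  \<open>('n, 'k) mpoly\<close> with \<open>'n\<close> finite is the polynomial ring over \<open>'k\<close> in \<open>CARD('n)\<close> variables:
  a polynomial maps exponent vectors to coefficients.
\<close>

type_synonym ('n, 'k) mpoly = "('n \<Rightarrow>\<^sub>0 nat) \<Rightarrow>\<^sub>0 'k"

definition mon_deg :: "('n::finite \<Rightarrow>\<^sub>0 nat) \<Rightarrow> nat" where
  "mon_deg t = (\<Sum>v\<in>UNIV. Poly_Mapping.lookup t v)"

text \<open>Membership in the degree \<open>d\<close> component of the standard grading; \<open>0\<close> lies in each component.\<close>

definition homogeneous :: "nat \<Rightarrow> ('n::finite, 'k::zero) mpoly \<Rightarrow> bool" where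
  "homogeneous d f \<longleftrightarrow> (\<forall>t\<in>Poly_Mapping.keys f. mon_deg t = d)"

text \<open>
  Ideals are the submodules of the ring over itself. This module structure is not interpreted: the
  simp rule for iterated scaling would loop with associativity.
\<close>

lemma module_times: "module ((*) :: 'a::comm_ring_1 \<Rightarrow> 'a \<Rightarrow> 'a)"
  by unfold_locales (simp_all add: algebra_simps)

definition ideal_span :: "'a::comm_ring_1 set \<Rightarrow> 'a set" where
  "ideal_span S = module.span (*) S"

definition homogeneous_ideal :: "('n::finite, 'k::comm_ring_1) mpoly set \<Rightarrow> bool" where
  "homogeneous_ideal I \<longleftrightarrow> (\<exists>S. (\<forall>f\<in>S. \<exists>d. homogeneous d f) \<and> I = ideal_span S)"

definition frobenius_power :: "nat \<Rightarrow> 'a::comm_ring_1 set \<Rightarrow> 'a set" where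
  "frobenius_power q I = ideal_span ((\<lambda>f. f ^ q) ` I)"

section \<open>Free modules\<close>

text \<open>
  The free \<open>'a\<close>-module on a set \<open>B\<close> of naturals consists of the finitely supported functions
  \<open>nat \<Rightarrow>\<^sub>0 'a\<close> with support in \<open>B\<close>.
\<close>

definition smult :: "'a::comm_ring_1 \<Rightarrow> (nat \<Rightarrow>\<^sub>0 'a) \<Rightarrow> (nat \<Rightarrow>\<^sub>0 'a)" where
  "smult c x = Poly_Mapping.map ((*) c) x"

lemma lookup_smult [simp]: "Poly_Mapping.lookup (smult c x) b = c * Poly_Mapping.lookup x b"
  by (simp add: smult_def Poly_Mapping.map.rep_eq when_def)

interpretation free: module "smult :: 'a::comm_ring_1 \<Rightarrow> (nat \<Rightarrow>\<^sub>0 'a) \<Rightarrow> (nat \<Rightarrow>\<^sub>0 'a)"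
  by unfold_locales (auto intro!: poly_mapping_eqI simp: lookup_add algebra_simps)

interpretation coord: vector_space "smult :: 'k::field \<Rightarrow> (nat \<Rightarrow>\<^sub>0 'k) \<Rightarrow> (nat \<Rightarrow>\<^sub>0 'k)"
  by unfold_locales (auto intro!: poly_mapping_eqI simp: lookup_add algebra_simps)

definition free_module :: "nat set \<Rightarrow> (nat \<Rightarrow>\<^sub>0 'a::zero) set" where
  "free_module B = {x. Poly_Mapping.keys x \<subseteq> B}"

text \<open>The linear map sending the basis element \<open>b\<close> to \<open>g b\<close>.\<close>

definition lin_ext :: "(nat \<Rightarrow> (nat \<Rightarrow>\<^sub>0 'a)) \<Rightarrow> (nat \<Rightarrow>\<^sub>0 'a::comm_ring_1) \<Rightarrow> (nat \<Rightarrow>\<^sub>0 'a)" where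
  "lin_ext g x = (\<Sum>b\<in>Poly_Mapping.keys x. smult (Poly_Mapping.lookup x b) (g b))"

section \<open>Graded free resolutions\<close>

text \<open>
  In homological degree \<open>i\<close> the module \<open>F\<^sub>i\<close> is free on \<open>gens F i\<close>, with \<open>b\<close> placed in internal
  degree \<open>gdeg F i b\<close>, that is, \<open>F\<^sub>i\<close> is the direct sum of the shifts \<open>R(-gdeg F i b)\<close>.
  The differential from \<open>F\<^sub>i\<^sub>+\<^sub>1\<close> to \<open>F\<^sub>i\<close> sends the basis element \<open>b\<close> to \<open>bdry F i b\<close> (note the index),
  and the augmentation from \<open>F\<^sub>0\<close> to \<open>R/I\<close> sends \<open>b\<close> to the class of \<open>aug F b\<close>.
\<close>

record (overloaded) ('n, 'k) free_complex =
  gens :: "nat \<Rightarrow> nat set"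
  gdeg :: "nat \<Rightarrow> nat \<Rightarrow> nat"
  aug :: "nat \<Rightarrow> ('n, 'k) mpoly"
  bdry :: "nat \<Rightarrow> nat \<Rightarrow> (nat \<Rightarrow>\<^sub>0 ('n, 'k) mpoly)"

definition differential ::
  "('n::finite, 'k::field) free_complex \<Rightarrow> nat \<Rightarrow> (nat \<Rightarrow>\<^sub>0 ('n, 'k) mpoly) \<Rightarrow> (nat \<Rightarrow>\<^sub>0 ('n, 'k) mpoly)"
  where "differential F i = lin_ext (bdry F i)"

definition augmentation ::
  "('n::finite, 'k::field) free_complex \<Rightarrow> (nat \<Rightarrow>\<^sub>0 ('n, 'k) mpoly) \<Rightarrow> ('n, 'k) mpoly" where
  "augmentation F x = (\<Sum>b\<in>Poly_Mapping.keys x. Poly_Mapping.lookup x b * aug F b)"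

definition homogeneous_vec :: "(nat \<Rightarrow> nat) \<Rightarrow> nat \<Rightarrow> (nat \<Rightarrow>\<^sub>0 ('n::finite, 'k::field) mpoly) \<Rightarrow> bool" where
  "homogeneous_vec dg d x \<longleftrightarrow>
     (\<forall>b\<in>Poly_Mapping.keys x. \<forall>t\<in>Poly_Mapping.keys (Poly_Mapping.lookup x b). mon_deg t + dg b = d)"

text \<open>
  Graded free resolutions of \<open>R/I\<close> with finitely many generators in each bidegree. They need be
  neither minimal nor of finite length, and the last three conditions are exactness at
  \<open>R/I\<close>, at \<open>F\<^sub>0\<close> and at \<open>F\<^sub>i\<^sub>+\<^sub>1\<close>.
\<close>

definition graded_free_resolution ::
  "('n::finite, 'k::field) mpoly set \<Rightarrow> ('n, 'k) free_complex \<Rightarrow> bool" where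
  "graded_free_resolution I F \<longleftrightarrow>
     (\<forall>i j. finite {b \<in> gens F i. gdeg F i b = j}) \<and>
     (\<forall>b\<in>gens F 0. homogeneous (gdeg F 0 b) (aug F b)) \<and>
     (\<forall>i. \<forall>b\<in>gens F (Suc i). bdry F i b \<in> free_module (gens F i) \<and>
            homogeneous_vec (gdeg F i) (gdeg F (Suc i) b) (bdry F i b)) \<and>
     (\<forall>r. \<exists>x\<in>free_module (gens F 0). r - augmentation F x \<in> I) \<and>
     {x \<in> free_module (gens F 0). augmentation F x \<in> I}
       = differential F 0 ` free_module (gens F (Suc 0)) \<and>
     (\<forall>i. {x \<in> free_module (gens F (Suc i)). differential F i x = 0}
            = differential F (Suc i) ` free_module (gens F (Suc (Suc i))))"

section \<open>Tor with the residue field and graded Betti numbers\<close>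

text \<open>
  The residue field \<open>K = R/(X\<^sub>1, \<dots>, X\<^sub>n)\<close> is an \<open>R\<close>-algebra through the map taking a polynomial to
  its constant coefficient. So the tensor product of \<open>K\<close> with the free module on \<open>B\<close> is the
  \<open>K\<close>-vector space on \<open>B\<close>, and the differential becomes the matrix of constant coefficients.
\<close>

definition const_coeff :: "('n, 'k::zero) mpoly \<Rightarrow> 'k" where
  "const_coeff f = Poly_Mapping.lookup f 0"

definition tensor_component :: "('n, 'k::field) free_complex \<Rightarrow> nat \<Rightarrow> nat \<Rightarrow> (nat \<Rightarrow>\<^sub>0 'k) set" where
  "tensor_component F i j = free_module {b \<in> gens F i. gdeg F i b = j}"

definition tensor_differential ::
  "('n, 'k::field) free_complex \<Rightarrow> nat \<Rightarrow> (nat \<Rightarrow>\<^sub>0 'k) \<Rightarrow> (nat \<Rightarrow>\<^sub>0 'k)" where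
  "tensor_differential F i = lin_ext (\<lambda>b. Poly_Mapping.map const_coeff (bdry F i b))"

fun tor_cycles :: "('n, 'k::field) free_complex \<Rightarrow> nat \<Rightarrow> nat \<Rightarrow> (nat \<Rightarrow>\<^sub>0 'k) set" where
  "tor_cycles F 0 j = tensor_component F 0 j"
| "tor_cycles F (Suc i) j = {x \<in> tensor_component F (Suc i) j. tensor_differential F i x = 0}"

definition tor_boundaries :: "('n, 'k::field) free_complex \<Rightarrow> nat \<Rightarrow> nat \<Rightarrow> (nat \<Rightarrow>\<^sub>0 'k) set" where
  "tor_boundaries F i j = tensor_differential F i ` tensor_component F (Suc i) j"

text \<open>
  For a resolution \<open>F\<close> of \<open>R/I\<close> this is the dimension of \<open>Tor\<^sub>i(K, R/I)\<^sub>j\<close>, the quotient of the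
  cycles by the boundaries. All spaces are finite-dimensional and boundaries are cycles, so the
  subtraction does not truncate.
\<close>

definition tor_dim :: "('n, 'k::field) free_complex \<Rightarrow> nat \<Rightarrow> nat \<Rightarrow> nat" where
  "tor_dim F i j = coord.dim (tor_cycles F i j) - coord.dim (tor_boundaries F i j)"

text \<open>
  \<open>graded_betti I i j\<close> is the Betti number of \<open>R/I\<close>, not of \<open>I\<close>. As \<open>Tor\<close> does not depend on the
  resolution, any one will do. Since \<open>R/I\<close> lives in degrees \<open>\<ge> 0\<close>, its \<open>Tor\<close> vanishes in negative
  internal degrees and natural numbers suffice for \<open>j\<close>.
\<close>

definition graded_betti :: "('n::finite, 'k::field) mpoly set \<Rightarrow> nat \<Rightarrow> nat \<Rightarrow> nat" where
  "graded_betti I i j = tor_dim (SOME F. graded_free_resolution I F) i j"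

definition extremal_betti :: "('n::finite, 'k::field) mpoly set \<Rightarrow> nat \<Rightarrow> nat \<Rightarrow> bool" where
  "extremal_betti I i j \<longleftrightarrow> graded_betti I i j \<noteq> 0 \<and>
     (\<forall>k l. (k, l) \<noteq> (i, j) \<and> i \<le> k \<and> j \<le> l \<longrightarrow> graded_betti I k l = 0)"

end

theory Submission
  imports Defs "HOL-Computational_Algebra.Primes" "HOL-Library.Nat_Bijection"
begin

text \<open>
  Put \<open>q = p\<^sup>e\<close>. The \<open>q\<close>-th power map of \<open>R\<close> is flat, because \<open>R\<close> is free over itself through it: a
  basis consists of the products of a monomial with exponents below \<open>q\<close> and an element of a
  basis of \<open>K\<close> over \<open>K\<^sup>q\<close>. So raising all entries of the matrices of a graded free resolution of \<open>R/I\<close> to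
  the power \<open>q\<close> and multiplying all shifts by \<open>q\<close> gives a resolution of \<open>R/I\<^sup>[\<^sup>q\<^sup>]\<close>. Modulo the
  variables, the matrices of the new resolution arise from those of the old one through the \<open>q\<close>-th
  power map of \<open>K\<close>, which is flat for the same reason. Hence \<open>\<beta>\<^sub>i\<^sub>,\<^sub>j(R/I\<^sup>[\<^sup>q\<^sup>])\<close> is nonzero iff
  \<open>j = q l\<close> with \<open>\<beta>\<^sub>i\<^sub>,\<^sub>l(R/I)\<close> nonzero. As extremality depends only on which Betti numbers vanish,
  dimensions need not be compared: the exactness of the complexes at single spots suffices.
\<close>

section \<open>Linear maps between free modules\<close>

text \<open>\<open>graded_betti\<close> picks its resolution by choice, so a computation in one
  convenient resolution says nothing until a resolution is known to exist and the vanishing of Tor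
  is known not to depend on it. The comparison of resolutions supplies this, for vanishing only,
  without constructing an isomorphism of Tor. The field may be imperfect and even infinite over its
  \<open>q\<close>-th powers, so a basis may be infinite and the argument has to be finitary.
  Freeness is used through the coordinate functions, additive maps \<open>c\<close> with
  \<open>c (a * f ^ q) = c a * f\<close>. They turn a matrix with entries \<open>g ^ q\<close> back
  into the matrix with entries \<open>g\<close>. Hence the coordinates of a cycle of the twisted
  complex are cycles of the old complex. If these are boundaries, with preimages \<open>z s\<close>,
  then the sum of the vectors \<open>smult (u s) (frv q (z s))\<close> is a preimage of the given
  cycle. This one argument serves twice: over the polynomial ring for exactness, and over the field
  for Tor.\<close>

abbreviation lookup where "lookup \<equiv> Poly_Mapping.lookup"
abbreviation keys where "keys \<equiv> Poly_Mapping.keys"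
abbreviation single where "single \<equiv> Poly_Mapping.single"

lemma additiveI: "(\<And>x y. f (x + y) = f x + f y) \<Longrightarrow> additive f"
  by (simp add: additive_def)

lemma lookup_map:
  assumes "f 0 = 0"
  shows "lookup (Poly_Mapping.map f x) b = f (lookup x b)"
  using assms by (simp add: Poly_Mapping.map.rep_eq when_def)

lemma keys_map_subset: "keys (Poly_Mapping.map f x) \<subseteq> keys x"
  by (auto simp: in_keys_iff Poly_Mapping.map.rep_eq when_def)

lemma smult_0_left [simp]: "smult 0 x = 0"
  by (rule free.scale_zero_left)

lemma smult_0_right [simp]: "smult c 0 = 0"
  by (rule free.scale_zero_right)

lemma smult_1 [simp]: "smult 1 x = x"
  by (rule poly_mapping_eqI) simp

lemma smult_single [simp]: "smult c (single b d) = single b (c * d)"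
  by (rule poly_mapping_eqI) (simp add: lookup_single when_def)

lemma lin_ext_superset:
  assumes "finite A" "keys x \<subseteq> A"
  shows "lin_ext g x = (\<Sum>b\<in>A. smult (lookup x b) (g b))"
  unfolding lin_ext_def
  by (rule sum.mono_neutral_left) (use assms in \<open>auto simp: in_keys_iff\<close>)

lemma lookup_lin_ext: "lookup (lin_ext g x) a = (\<Sum>b\<in>keys x. lookup x b * lookup (g b) a)"
  by (simp add: lin_ext_def lookup_sum)

lemma lin_ext_0 [simp]: "lin_ext g 0 = 0"
  by (simp add: lin_ext_def)

lemma lin_ext_single [simp]: "lin_ext g (single b c) = smult c (g b)"
  by (cases "c = 0") (simp_all add: lin_ext_def)

lemma lin_ext_add: "lin_ext g (x + y) = lin_ext g x + lin_ext g y"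
proof -
  let ?A = "keys x \<union> keys y"
  have "lin_ext g (x + y) = (\<Sum>b\<in>?A. smult (lookup (x + y) b) (g b))"
    by (rule lin_ext_superset) (use keys_add[of x y] in auto)
  also have "\<dots> = (\<Sum>b\<in>?A. smult (lookup x b) (g b)) + (\<Sum>b\<in>?A. smult (lookup y b) (g b))"
    by (simp add: lookup_add free.scale_left_distrib sum.distrib)
  also have "\<dots> = lin_ext g x + lin_ext g y"
    by (simp add: lin_ext_superset[of ?A])
  finally show ?thesis .
qed

lemma additive_lin_ext: "additive (lin_ext g)"
  by (rule additiveI) (rule lin_ext_add)

lemmas lin_ext_diff = additive.diff[OF additive_lin_ext]
lemmas lin_ext_sum = additive.sum[OF additive_lin_ext]

lemma lin_ext_smult: "lin_ext g (smult c x) = smult c (lin_ext g x)"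
proof -
  have "lin_ext g (smult c x) = (\<Sum>b\<in>keys x. smult (lookup (smult c x) b) (g b))"
    by (rule lin_ext_superset) (auto simp: in_keys_iff)
  also have "\<dots> = (\<Sum>b\<in>keys x. smult c (smult (lookup x b) (g b)))"
    by (simp add: free.scale_scale)
  finally show ?thesis
    by (simp add: lin_ext_def free.scale_sum_right)
qed

lemma lin_ext_cong:
  "(\<And>b. b \<in> keys x \<Longrightarrow> f b = g b) \<Longrightarrow> lin_ext f x = lin_ext g x"
  by (simp add: lin_ext_def)

lemma lin_ext_lin_ext: "lin_ext g (lin_ext f x) = lin_ext (\<lambda>b. lin_ext g (f b)) x"
  by (simp add: lin_ext_def[of f] lin_ext_sum lin_ext_smult) (simp add: lin_ext_def)

lemma lin_ext_single_one [simp]: "lin_ext (\<lambda>b. single b 1) x = x"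
proof (rule poly_mapping_eqI)
  fix a
  show "lookup (lin_ext (\<lambda>b. single b 1) x) a = lookup x a"
    by (simp add: lookup_lin_ext lookup_single when_def if_distrib sum.delta in_keys_iff
        cong: if_cong)
qed

lemma lin_ext_diff_fun: "lin_ext (\<lambda>b. f b - g b) x = lin_ext f x - lin_ext g x"
  by (simp add: lin_ext_def free.scale_right_diff_distrib sum_subtractf)

text \<open>A common generalization of two cases. With \<open>f\<close> the identity and
  \<open>l = h\<close>, it says that a ring homomorphism may be applied to a matrix and a vector
  separately. With \<open>f\<close> the \<open>q\<close>-th power and \<open>l\<close> the identity,
  it says that a coordinate function removes the power from the matrix.\<close>

lemma map_lin_ext:
  assumes "additive h" "f 0 = 0" "l 0 = 0" "\<And>a v. h (a * f v) = h a * l v"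
  shows "Poly_Mapping.map h (lin_ext (\<lambda>b. Poly_Mapping.map f (g b)) x) =
    lin_ext (\<lambda>b. Poly_Mapping.map l (g b)) (Poly_Mapping.map h x)"
proof (rule poly_mapping_eqI)
  fix a
  have h0: "h 0 = 0"
    by (rule additive.zero) fact
  have "lookup (lin_ext (\<lambda>b. Poly_Mapping.map l (g b)) (Poly_Mapping.map h x)) a =
    (\<Sum>b\<in>keys x. h (lookup x b) * l (lookup (g b) a))"
    by (simp add: lin_ext_superset[OF finite_keys keys_map_subset] lookup_sum lookup_map h0 assms)
  then show "lookup (Poly_Mapping.map h (lin_ext (\<lambda>b. Poly_Mapping.map f (g b)) x)) a =
    lookup (lin_ext (\<lambda>b. Poly_Mapping.map l (g b)) (Poly_Mapping.map h x)) a"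
    by (simp add: lookup_map h0 assms lookup_lin_ext additive.sum[OF assms(1)])
qed

lemma map_lin_ext_hom:
  assumes "additive h" "\<And>a b. h (a * b) = h a * h b"
  shows "Poly_Mapping.map h (lin_ext g x) =
    lin_ext (\<lambda>b. Poly_Mapping.map h (g b)) (Poly_Mapping.map h x)"
proof -
  have "Poly_Mapping.map (\<lambda>c. c) y = y" for y :: "nat \<Rightarrow>\<^sub>0 'a"
    by (rule poly_mapping_eqI) (simp add: lookup_map)
  then show ?thesis
    using map_lin_ext[OF assms(1), of "\<lambda>c. c" h g x] assms additive.zero[OF assms(1)] by simp
qed

lemma free_module_iff: "x \<in> free_module B \<longleftrightarrow> (\<forall>b. lookup x b \<noteq> 0 \<longrightarrow> b \<in> B)"
  by (auto simp: free_module_def in_keys_iff)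

lemma free_module_0 [simp]: "0 \<in> free_module B"
  by (simp add: free_module_iff)

lemma free_module_add: "x \<in> free_module B \<Longrightarrow> y \<in> free_module B \<Longrightarrow> x + y \<in> free_module B"
  by (auto simp: free_module_iff lookup_add) (metis add_0)

lemma free_module_diff:
  "x \<in> free_module B \<Longrightarrow> y \<in> free_module B \<Longrightarrow> x - y \<in> free_module (B :: nat set)"
  for x y :: "nat \<Rightarrow>\<^sub>0 'a::ab_group_add"
  by (auto simp: free_module_iff lookup_minus) (metis diff_0_right)

lemma free_module_smult: "x \<in> free_module B \<Longrightarrow> smult c x \<in> free_module B"
  by (metis free_module_iff lookup_smult mult_zero_right)

lemma free_module_sum:
  "(\<And>i. i \<in> A \<Longrightarrow> f i \<in> free_module B) \<Longrightarrow> sum f A \<in> free_module B"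
  by (induction A rule: infinite_finite_induct) (simp_all add: free_module_add)

lemma free_module_map: "x \<in> free_module B \<Longrightarrow> Poly_Mapping.map f x \<in> free_module B"
  using keys_map_subset[of f x] by (auto simp: free_module_def)

lemma free_module_single: "b \<in> B \<Longrightarrow> single b c \<in> free_module B"
  by (auto simp: free_module_iff lookup_single when_def)

lemma free_module_lin_ext:
  assumes "x \<in> free_module B" "\<And>b. b \<in> B \<Longrightarrow> g b \<in> free_module C"
  shows "lin_ext g x \<in> free_module C"
  unfolding lin_ext_def
  by (intro free_module_sum free_module_smult assms(2)) (use assms(1) in \<open>auto simp: free_module_def\<close>)

section \<open>Homogeneous components\<close>

lemma mon_deg_0 [simp]: "mon_deg 0 = 0"
  by (simp add: mon_deg_def)

lemma mon_deg_add: "mon_deg (s + t) = mon_deg s + mon_deg t"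
  by (simp add: mon_deg_def lookup_add sum.distrib)

lemma finite_mon_deg: "finite {t :: 'n::finite \<Rightarrow>\<^sub>0 nat. mon_deg t = d}"
proof -
  have "lookup ` {t :: 'n \<Rightarrow>\<^sub>0 nat. mon_deg t = d} \<subseteq> {f. \<forall>v. f v \<in> {..d}}"
    by (auto simp: mon_deg_def intro: member_le_sum)
  then have "finite (lookup ` {t :: 'n \<Rightarrow>\<^sub>0 nat. mon_deg t = d})"
  proof (rule finite_subset)
    show "finite {f :: 'n \<Rightarrow> nat. \<forall>v. f v \<in> {..d}}"
      using finite_set_of_finite_funs[of "UNIV :: 'n set" "{..d}" undefined] by simp
  qed
  moreover have "inj_on lookup {t :: 'n \<Rightarrow>\<^sub>0 nat. mon_deg t = d}"
    by (intro inj_onI poly_mapping_eqI) (rule fun_cong)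
  ultimately show ?thesis
    by (rule finite_imageD)
qed

lemma homogeneous_iff: "homogeneous d f \<longleftrightarrow> (\<forall>t. lookup f t \<noteq> 0 \<longrightarrow> mon_deg t = d)"
  by (auto simp: homogeneous_def in_keys_iff)

lemma homogeneous_mult:
  fixes f g :: "('n::finite, 'k::comm_ring_1) mpoly"
  assumes "homogeneous d f" "homogeneous e g"
  shows "homogeneous (d + e) (f * g)"
  using assms keys_mult[of f g] by (force simp: homogeneous_def mon_deg_add)

lemma homogeneous_power:
  fixes f :: "('n::finite, 'k::comm_ring_1) mpoly"
  assumes "homogeneous d f"
  shows "homogeneous (q * d) (f ^ q)"
proof (induction q)
  case 0
  then show ?case by (simp add: homogeneous_def)
next
  case (Suc q)
  then show ?case using homogeneous_mult[OF assms Suc] by simp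
qed

lemma homogeneous_vec_iff:
  "homogeneous_vec dg d x \<longleftrightarrow> (\<forall>b t. lookup (lookup x b) t \<noteq> 0 \<longrightarrow> mon_deg t + dg b = d)"
  by (auto simp: homogeneous_vec_def in_keys_iff) (metis in_keys_iff lookup_zero)

lemma homogeneous_vec_0 [simp]: "homogeneous_vec dg d 0"
  by (simp add: homogeneous_vec_def)

lemma homogeneous_vec_add:
  "homogeneous_vec dg d x \<Longrightarrow> homogeneous_vec dg d y \<Longrightarrow> homogeneous_vec dg d (x + y)"
  by (auto simp: homogeneous_vec_iff lookup_add) (metis add_0)

lemma homogeneous_vec_diff:
  "homogeneous_vec dg d x \<Longrightarrow> homogeneous_vec dg d y \<Longrightarrow> homogeneous_vec dg d (x - y)"
  by (auto simp: homogeneous_vec_iff lookup_minus) (metis diff_0_right)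

lemma homogeneous_vec_sum:
  "(\<And>i. i \<in> A \<Longrightarrow> homogeneous_vec dg d (f i)) \<Longrightarrow> homogeneous_vec dg d (sum f A)"
  by (induction A rule: infinite_finite_induct) (simp_all add: homogeneous_vec_add)

lemma homogeneous_vec_smult:
  assumes "homogeneous d f" "homogeneous_vec dg e x"
  shows "homogeneous_vec dg (d + e) (smult f x)"
  unfolding homogeneous_vec_def
proof (intro ballI)
  fix b t assume "t \<in> keys (lookup (smult f x) b)"
  then have "t \<in> keys (f * lookup x b)"
    by simp
  then obtain r s where "t = r + s" "r \<in> keys f" "s \<in> keys (lookup x b)"
    using keys_mult[of f "lookup x b"] by blast
  moreover from this have "b \<in> keys x"
    by (auto simp: in_keys_iff)
  ultimately show "mon_deg t + dg b = d + e"
    using assms by (fastforce simp: homogeneous_def homogeneous_vec_def mon_deg_add)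
qed

section \<open>Projection onto homogeneous components\<close>

definition hpart :: "nat \<Rightarrow> ('n::finite, 'k::field) mpoly \<Rightarrow> ('n, 'k) mpoly" where
  "hpart d f = Poly_Mapping.mapp (\<lambda>t c. c when mon_deg t = d) f"

text \<open>The guard \<open>dg b \<le> d\<close> is essential because subtraction truncates:
  without it, a coefficient at a generator of degree above \<open>d\<close> would contribute its
  constant term.\<close>

definition hcomp :: "(nat \<Rightarrow> nat) \<Rightarrow> nat \<Rightarrow> (nat \<Rightarrow>\<^sub>0 ('n::finite, 'k::field) mpoly) \<Rightarrow> (nat \<Rightarrow>\<^sub>0 ('n, 'k) mpoly)" where
  "hcomp dg d x = Poly_Mapping.mapp (\<lambda>b f. hpart (d - dg b) f when dg b \<le> d) x"

lemma lookup_hpart [simp]: "lookup (hpart d f) t = (lookup f t when mon_deg t = d)"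
  by (auto simp: hpart_def lookup_mapp when_def in_keys_iff)

lemma hpart_0 [simp]: "hpart d 0 = 0"
  by (rule poly_mapping_eqI) simp

lemma lookup_hcomp: "lookup (hcomp dg d x) b = (hpart (d - dg b) (lookup x b) when dg b \<le> d)"
  by (auto simp: hcomp_def lookup_mapp when_def in_keys_iff)

lemma lookup_lookup_hcomp:
  "lookup (lookup (hcomp dg d x) b) t = (lookup (lookup x b) t when mon_deg t + dg b = d)"
  by (auto simp: lookup_hcomp when_def)

lemma poly_mapping_eqI2: "(\<And>b t. lookup (lookup x b) t = lookup (lookup y b) t) \<Longrightarrow> x = y"
  by (intro poly_mapping_eqI)

lemma additive_hcomp: "additive (hcomp dg d)"
  by (rule additiveI, rule poly_mapping_eqI2) (simp add: lookup_lookup_hcomp lookup_add when_def)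

lemma homogeneous_hpart: "homogeneous d (hpart d f)"
  by (simp add: homogeneous_iff)

lemma homogeneous_vec_hcomp: "homogeneous_vec dg d (hcomp dg d x)"
  by (simp add: homogeneous_vec_iff lookup_lookup_hcomp)

lemma hcomp_homogeneous_vec:
  assumes "homogeneous_vec dg d x"
  shows "hcomp dg e x = (x when e = d)"
  using assms
  by (intro poly_mapping_eqI2) (auto simp: lookup_lookup_hcomp homogeneous_vec_iff when_def)

lemma hcomp_free_module: "x \<in> free_module B \<Longrightarrow> hcomp dg d x \<in> free_module B"
  by (auto simp: free_module_iff lookup_hcomp) (metis hpart_0)

text \<open>Only finitely many degrees occur in \<open>x\<close>. The bound is stated for every
  larger \<open>M\<close>, so that the range can be enlarged to contain a prescribed degree.\<close>

lemma sum_hcomp: "\<exists>N. \<forall>M\<ge>N. (\<Sum>d<M. hcomp dg d x) = x"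
proof -
  define D where "D = (\<Union>b\<in>keys x. (\<lambda>t. mon_deg t + dg b) ` keys (lookup x b))"
  have "finite D"
    by (simp add: D_def)
  then obtain N where N: "\<And>d. d \<in> D \<Longrightarrow> d < N"
    using finite_nat_set_iff_bounded by auto
  have "(\<Sum>d<M. hcomp dg d x) = x" if "N \<le> M" for M
  proof (rule poly_mapping_eqI2)
    fix b t
    have "mon_deg t + dg b < M" if "lookup (lookup x b) t \<noteq> 0"
    proof -
      have "mon_deg t + dg b \<in> D"
        using that by (force simp: D_def in_keys_iff)
      then show ?thesis
        using N \<open>N \<le> M\<close> by fastforce
    qed
    then show "lookup (lookup (\<Sum>d<M. hcomp dg d x) b) t = lookup (lookup x b) t"
      by (auto simp: lookup_sum lookup_lookup_hcomp when_def)
  qed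
  then show ?thesis
    by (intro exI allI impI)
qed

section \<open>Degree-preserving maps of graded free modules\<close>

definition gr_hom :: "nat set \<Rightarrow> (nat \<Rightarrow> nat) \<Rightarrow> nat set \<Rightarrow> (nat \<Rightarrow> nat) \<Rightarrow>
    (nat \<Rightarrow> (nat \<Rightarrow>\<^sub>0 ('n::finite, 'k::field) mpoly)) \<Rightarrow> bool" where
  "gr_hom B dg C dg' g \<longleftrightarrow> (\<forall>b\<in>B. g b \<in> free_module C \<and> homogeneous_vec dg' (dg b) (g b))"

lemma gr_hom_free_module:
  "gr_hom B dg C dg' g \<Longrightarrow> x \<in> free_module B \<Longrightarrow> lin_ext g x \<in> free_module C"
  by (rule free_module_lin_ext) (auto simp: gr_hom_def)

lemma gr_hom_homogeneous_vec:
  assumes "gr_hom B dg C dg' g" "x \<in> free_module B" "homogeneous_vec dg d x"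
  shows "homogeneous_vec dg' d (lin_ext g x)"
  unfolding lin_ext_def
proof (rule homogeneous_vec_sum)
  fix b assume b: "b \<in> keys x"
  \<comment> \<open>A monomial of the nonzero coefficient witnesses \<open>dg b \<le> d\<close>, so
    \<open>d - dg b\<close> is a true difference.\<close>
  then obtain t where "t \<in> keys (lookup x b)"
    by (metis in_keys_iff keys_eq_empty equals0I)
  then have "dg b \<le> d" "homogeneous (d - dg b) (lookup x b)"
    using assms(3) b by (fastforce simp: homogeneous_vec_def homogeneous_def)+
  moreover have "homogeneous_vec dg' (dg b) (g b)"
    using assms(1,2) b by (auto simp: gr_hom_def free_module_def)
  ultimately show "homogeneous_vec dg' d (smult (lookup x b) (g b))"
    using homogeneous_vec_smult by fastforce
qed

text \<open>The image of the degree \<open>e\<close> component of \<open>x\<close> is homogeneous of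
  degree \<open>e\<close>, so extracting degree \<open>d\<close> from the image selects the single
  summand \<open>e = d\<close>.\<close>

lemma hcomp_lin_ext:
  assumes "gr_hom B dg C dg' g" "x \<in> free_module B"
  shows "hcomp dg' d (lin_ext g x) = lin_ext g (hcomp dg d x)"
proof -
  obtain N where "\<forall>M\<ge>N. (\<Sum>d<M. hcomp dg d x) = x"
    using sum_hcomp[of dg x] by auto
  \<comment> \<open>\<open>Suc d\<close> makes sure that the index \<open>d\<close> itself lies in
    the range of summation.\<close>
  then have "(\<Sum>e<max N (Suc d). hcomp dg e x) = x"
    by simp
  then have "hcomp dg' d (lin_ext g x) =
      hcomp dg' d (\<Sum>e<max N (Suc d). lin_ext g (hcomp dg e x))"
    by (metis lin_ext_sum)
  also have "\<dots> = (\<Sum>e<max N (Suc d). hcomp dg' d (lin_ext g (hcomp dg e x)))"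
    by (rule additive.sum[OF additive_hcomp])
  also have "\<dots> = (\<Sum>e<max N (Suc d). lin_ext g (hcomp dg e x) when d = e)"
    by (intro sum.cong refl hcomp_homogeneous_vec gr_hom_homogeneous_vec[OF assms(1)]
        hcomp_free_module assms(2) homogeneous_vec_hcomp)
  also have "\<dots> = lin_ext g (hcomp dg d x)"
    by (simp add: when_def less_max_iff_disj)
  finally show ?thesis .
qed

lemma homogeneous_vec_single [simp]:
  "homogeneous_vec dg d (single b f) \<longleftrightarrow> (\<forall>t. lookup f t \<noteq> 0 \<longrightarrow> mon_deg t + dg b = d)"
  by (auto simp: homogeneous_vec_iff lookup_single when_def)

lemma hcomp_single: "hcomp dg d (single b f) = single b (hpart (d - dg b) f when dg b \<le> d)"
  by (rule poly_mapping_eqI) (auto simp: lookup_hcomp lookup_single when_def)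

text \<open>Multiplication by \<open>s\<close> is a degree-preserving map between free modules of
  rank one whose generators have degrees \<open>e\<close> and \<open>0\<close>, so
  \<open>hcomp_lin_ext\<close> applies.\<close>

lemma hpart_mult_homogeneous:
  assumes "homogeneous e s"
  shows "hpart d (r * s) = ((hpart (d - e) r when e \<le> d) * s)"
proof -
  have "gr_hom {0} (\<lambda>_. e) {0} (\<lambda>_. 0) (\<lambda>_. single 0 s)"
    using assms by (auto simp: gr_hom_def free_module_single homogeneous_iff)
  from hcomp_lin_ext[OF this, of "single 0 r" d]
  have "single (0::nat) (hpart d (r * s)) = single 0 ((hpart (d - e) r when e \<le> d) * s)"
    by (simp add: free_module_single hcomp_single)
  then show ?thesis
    by (metis lookup_single_eq)
qed

lemma sum_hpart: "\<exists>N. (\<Sum>d<N. hpart d f) = f"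
proof -
  obtain N where "\<forall>M\<ge>N. (\<Sum>d<M. hcomp (\<lambda>_. 0) d (single 0 f)) = single (0::nat) f"
    using sum_hcomp[of "\<lambda>_. 0" "single 0 f"] by auto
  then have "(\<Sum>d<N. hcomp (\<lambda>_. 0) d (single 0 f)) = single (0::nat) f"
    by simp
  then have "lookup (\<Sum>d<N. hcomp (\<lambda>_. 0) d (single 0 f)) 0 = f"
    by simp
  then show ?thesis
    by (intro exI) (simp add: lookup_sum hcomp_single)
qed

section \<open>Existence of graded free resolutions\<close>

lemma additive_hpart: "additive (hpart d)"
  by (rule additiveI, rule poly_mapping_eqI) (simp add: lookup_add when_def)

definition graded_ideal :: "('n::finite, 'k::field) mpoly set \<Rightarrow> bool" where
  "graded_ideal I \<longleftrightarrow> module.subspace (*) I \<and> (\<forall>f\<in>I. \<forall>d. hpart d f \<in> I)"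

lemma subspace_ideal_span: "module.subspace (*) (ideal_span S)"
  unfolding ideal_span_def by (rule module.subspace_span[OF module_times])

lemmas ideal_0 = module.subspace_0[OF module_times]
lemmas ideal_add = module.subspace_add[OF module_times]
lemmas ideal_diff = module.subspace_diff[OF module_times]
lemmas ideal_mult = module.subspace_scale[OF module_times]
lemmas ideal_sum = module.subspace_sum[OF module_times]

text \<open>Each component of a multiple \<open>r * a\<close> of a homogeneous generator is again a
  multiple of \<open>a\<close>, and components are additive.\<close>

lemma homogeneous_ideal_imp_graded_ideal:
  assumes "homogeneous_ideal I"
  shows "graded_ideal I"
proof -
  obtain S where S: "\<And>f. f \<in> S \<Longrightarrow> \<exists>d. homogeneous d f" and I: "I = ideal_span S"
    using assms by (auto simp: homogeneous_ideal_def)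
  have "hpart d f \<in> I" if "f \<in> I" for f d
  proof -
    from that obtain t r where t: "finite t" "t \<subseteq> S" and f: "f = (\<Sum>a\<in>t. r a * a)"
      unfolding I ideal_span_def module.span_explicit[OF module_times] by blast
    have "hpart d (r a * a) \<in> I" if a: "a \<in> t" for a
    proof -
      obtain e where "homogeneous e a"
        using S t a by blast
      then have "hpart d (r a * a) = (hpart (d - e) (r a) when e \<le> d) * a"
        by (rule hpart_mult_homogeneous)
      moreover have "a \<in> I"
        unfolding I ideal_span_def using t a
        by (intro module.span_base[OF module_times]) auto
      ultimately show ?thesis
        by (simp add: I ideal_mult[OF subspace_ideal_span])
    qed
    then show ?thesis
      unfolding f additive.sum[OF additive_hpart] I by (rule ideal_sum[OF subspace_ideal_span])
  qed
  then show ?thesis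
    using I subspace_ideal_span by (auto simp: graded_ideal_def)
qed

section \<open>Graded submodules and their generators\<close>

definition graded_submodule ::
  "nat set \<Rightarrow> (nat \<Rightarrow> nat) \<Rightarrow> (nat \<Rightarrow>\<^sub>0 ('n::finite, 'k::field) mpoly) set \<Rightarrow> bool" where
  "graded_submodule B dg M \<longleftrightarrow>
     M \<subseteq> free_module B \<and> free.subspace M \<and> (\<forall>x\<in>M. \<forall>d. hcomp dg d x \<in> M)"

lemma sum_single_lookup: "(\<Sum>t\<in>keys f. single t (lookup f t)) = f"
proof (rule poly_mapping_eqI)
  fix s
  show "lookup (\<Sum>t\<in>keys f. single t (lookup f t)) s = lookup f s"
    by (simp add: lookup_sum lookup_single when_def sum.delta in_keys_iff)
qed

lemma single_sum: "single b (sum f A) = (\<Sum>a\<in>A. single b (f a))"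
  by (induction A rule: infinite_finite_induct) (simp_all add: single_add)

text \<open>
  Vector space bases of all graded components generate. This redundant choice makes resolutions
  exist without Noetherianity or Nakayama's lemma.
\<close>

lemma graded_submodule_generators:
  fixes M :: "(nat \<Rightarrow>\<^sub>0 ('n::finite, 'k::field) mpoly) set"
  assumes M: "graded_submodule B dg M" and fin: "\<And>j. finite {b \<in> B. dg b = j}"
  shows "\<exists>C dg' g. (\<forall>j. finite {c \<in> C. dg' c = j}) \<and> gr_hom C dg' B dg g \<and>
    M = lin_ext g ` free_module C"
proof -
  \<comment> \<open>Scalars from the field act as constant polynomials, so that finite-dimensional
    linear algebra is available in each degree.\<close>
  interpret V: vector_space
    "\<lambda>c. smult (single 0 c) :: (nat \<Rightarrow>\<^sub>0 ('n, 'k) mpoly) \<Rightarrow> (nat \<Rightarrow>\<^sub>0 ('n, 'k) mpoly)"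
    by unfold_locales
      (simp_all add: free.scale_right_distrib free.scale_left_distrib single_add mult_single)
  have sub: "free.subspace M"
    using M by (simp add: graded_submodule_def)
  define D where "D d = {x \<in> M. homogeneous_vec dg d x}" for d
  have "\<exists>S. finite S \<and> S \<subseteq> D d \<and> D d \<subseteq> V.span S" for d
  proof -
    \<comment> \<open>The products of a monomial and a basis element, both of degree at most
      \<open>d\<close>, span the degree \<open>d\<close> part of the whole free module. The
      finiteness of this set bounds the dimension of \<open>D d\<close>.\<close>
    define T where "T = (\<lambda>(b, t). single b (single t (1::'k))) `
      ((\<Union>j\<le>d. {b \<in> B. dg b = j}) \<times> (\<Union>j\<le>d. {t :: 'n \<Rightarrow>\<^sub>0 nat. mon_deg t = j}))"
    have "finite T"
      using fin by (auto simp: T_def finite_mon_deg)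
    have "D d \<subseteq> V.span T"
    proof
      fix x assume "x \<in> D d"
      then have x: "x \<in> free_module B" "homogeneous_vec dg d x"
        using M by (auto simp: D_def graded_submodule_def)
      have "x = (\<Sum>b\<in>keys x. single b (\<Sum>t\<in>keys (lookup x b). single t (lookup (lookup x b) t)))"
        by (simp add: sum_single_lookup)
      also have "\<dots> = (\<Sum>b\<in>keys x. \<Sum>t\<in>keys (lookup x b).
          smult (single 0 (lookup (lookup x b) t)) (single b (single t 1)))"
        by (simp add: single_sum mult_single)
      also have "\<dots> \<in> V.span T"
      proof (intro V.span_sum V.span_scale V.span_base)
        fix b t assume "b \<in> keys x" "t \<in> keys (lookup x b)"
        then have "b \<in> B" "mon_deg t + dg b = d"
          using x by (auto simp: free_module_def homogeneous_vec_def)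
        then have "(b, t) \<in> (\<Union>j\<le>d. {b \<in> B. dg b = j}) \<times> (\<Union>j\<le>d. {t. mon_deg t = j})"
          by auto
        then show "single b (single t 1) \<in> T"
          unfolding T_def by force
      qed
      finally show "x \<in> V.span T" .
    qed
    obtain S where S: "S \<subseteq> D d" "V.independent S" "D d \<subseteq> V.span S"
      by (rule V.basis_exists)
    then have "finite S"
      using V.independent_span_bound[OF \<open>finite T\<close> S(2)] \<open>D d \<subseteq> V.span T\<close> by (meson order_trans)
    with S show ?thesis by blast
  qed
  then obtain S where S: "\<And>d. finite (S d)" "\<And>d. S d \<subseteq> D d" "\<And>d. D d \<subseteq> V.span (S d)"
    by metis
  have "\<exists>n h. S d = h ` {..<n::nat}" for d
    using S(1)[of d] by (metis finite_imp_nat_seg_image_inj_on lessThan_def)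
  then obtain n h where h: "\<And>d. S d = h d ` {..<n d::nat}"
    by metis
  \<comment> \<open>A generator is a coded pair of its degree and its position in the basis
    \<open>S d\<close>. Reading off the first entry as the degree leaves only \<open>n j\<close>
    generators in degree \<open>j\<close>.\<close>
  define C where "C = prod_encode ` (SIGMA d:UNIV. {..<n d})"
  define dg' where "dg' = fst \<circ> prod_decode"
  define g where "g = case_prod h \<circ> prod_decode"
  have finC: "finite {c \<in> C. dg' c = j}" for j
  proof (rule finite_subset)
    show "{c \<in> C. dg' c = j} \<subseteq> prod_encode ` ({j} \<times> {..<n j})"
      by (auto simp: C_def dg'_def)
  qed auto
  have gD: "g c \<in> D (dg' c)" if "c \<in> C" for c
    using that S(2) h by (fastforce simp: C_def g_def dg'_def)
  have hom: "gr_hom C dg' B dg g"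
    using gD M by (auto simp: gr_hom_def D_def graded_submodule_def)
  let ?L = "lin_ext g ` free_module C"
  have subL: "free.subspace ?L"
  proof (rule free.subspaceI)
    show "0 \<in> ?L"
      by (rule image_eqI[of _ _ 0]) simp_all
    show "x + y \<in> ?L" if "x \<in> ?L" "y \<in> ?L" for x y
      using that by (auto simp flip: lin_ext_add intro: free_module_add)
    show "smult c x \<in> ?L" if "x \<in> ?L" for c x
      using that by (auto simp flip: lin_ext_smult intro: free_module_smult)
  qed
  have "?L \<subseteq> M"
  proof safe
    fix x :: "nat \<Rightarrow>\<^sub>0 ('n, 'k) mpoly" assume "x \<in> free_module C"
    then show "lin_ext g x \<in> M"
      unfolding lin_ext_def free_module_def
      using gD by (intro free.subspace_sum free.subspace_scale sub) (auto simp: D_def)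
  qed
  moreover have "M \<subseteq> ?L"
  proof
    fix x assume "x \<in> M"
    have "S d \<subseteq> ?L" for d
    proof
      fix s assume "s \<in> S d"
      then obtain k where "k < n d" "s = h d k"
        using h by auto
      then have "prod_encode (d, k) \<in> C" "s = lin_ext g (single (prod_encode (d, k)) 1)"
        by (auto simp: C_def g_def)
      then show "s \<in> ?L"
        using free_module_single by blast
    qed
    moreover have "V.subspace ?L"
      using subL unfolding V.subspace_def free.subspace_def by blast
    ultimately have "V.span (S d) \<subseteq> ?L" for d
      by (rule V.span_minimal)
    moreover have "hcomp dg d x \<in> D d" for d
      using M \<open>x \<in> M\<close> by (simp add: D_def graded_submodule_def homogeneous_vec_hcomp)
    ultimately have L: "hcomp dg d x \<in> ?L" for d
      using S(3) by blast
    obtain N where "\<forall>M\<ge>N. (\<Sum>d<M. hcomp dg d x) = x"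
      using sum_hcomp[of dg x] by auto
    then have "x = (\<Sum>d<N. hcomp dg d x)"
      by simp
    then show "x \<in> ?L"
      using free.subspace_sum[OF subL] L by metis
  qed
  ultimately show ?thesis
    using finC hom by blast
qed

lemma graded_submodule_kernel:
  assumes "gr_hom C dg' B dg g"
  shows "graded_submodule C dg' {x \<in> free_module C. lin_ext g x = 0}"
  unfolding graded_submodule_def
proof (intro conjI ballI allI)
  show "free.subspace {x \<in> free_module C. lin_ext g x = 0}"
    by (rule free.subspaceI) (auto simp: lin_ext_add lin_ext_smult free_module_add free_module_smult)
  show "hcomp dg' d x \<in> {x \<in> free_module C. lin_ext g x = 0}"
    if "x \<in> {x \<in> free_module C. lin_ext g x = 0}" for x d
    using that hcomp_lin_ext[OF assms, of x d, symmetric] additive.zero[OF additive_hcomp, of dg d]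
    by (simp add: hcomp_free_module)
qed auto

text \<open>Reading the augmentation as a map into a free module of rank one lets it inherit the
  facts about \<open>lin_ext\<close>.\<close>

lemma augmentation_eq: "augmentation F x = lookup (lin_ext (\<lambda>b. single 0 (aug F b)) x) 0"
  by (simp add: augmentation_def lookup_lin_ext)

lemma free_module_singleton: "x \<in> free_module {b} \<Longrightarrow> x = single b (lookup x b)"
  by (rule poly_mapping_eqI) (auto simp: free_module_iff lookup_single when_def)

lemma graded_free_resolution_exists:
  fixes I :: "('n::finite, 'k::field) mpoly set"
  assumes "graded_ideal I"
  shows "\<exists>F. graded_free_resolution I F"
proof -
  \<comment> \<open>A state is a graded free module together with the submodule that the next map
    has to cover. The construction starts with the ring itself and \<open>I\<close>, and the next
    submodule is always the kernel of the map just chosen.\<close>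
  let ?P = "\<lambda>(B, dg, M :: (nat \<Rightarrow>\<^sub>0 ('n, 'k) mpoly) set).
    (\<forall>j::nat. finite {b \<in> B. dg b = j}) \<and> graded_submodule B dg M"
  let ?R = "\<lambda>(B, dg, M) (B', dg', M') g. gr_hom B' dg' B dg g \<and> M = lin_ext g ` free_module B' \<and>
    M' = {x \<in> free_module B'. lin_ext g x = 0}"
  define M0 where "M0 = {x \<in> free_module {0::nat}. lookup x 0 \<in> I}"
  have I: "module.subspace (*) I" "\<And>f d. f \<in> I \<Longrightarrow> hpart d f \<in> I"
    using assms by (auto simp: graded_ideal_def)
  have M0: "graded_submodule {0} (\<lambda>_. 0) M0"
    unfolding graded_submodule_def
  proof (intro conjI ballI allI)
    show "free.subspace M0"
      by (rule free.subspaceI)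
        (auto simp: M0_def lookup_add free_module_add free_module_smult
          intro: ideal_0[OF I(1)] ideal_add[OF I(1)] ideal_mult[OF I(1)])
    show "hcomp (\<lambda>_. 0) d x \<in> M0" if "x \<in> M0" for x d
      using that I(2) by (simp add: M0_def hcomp_free_module lookup_hcomp)
  qed (auto simp: M0_def)
  have "\<exists>s. \<forall>i. (?P (s i) \<and> (i = 0 \<longrightarrow> s i = ({0}, (\<lambda>_. 0), M0))) \<and> (\<exists>g. ?R (s i) (s (Suc i)) g)"
  proof (rule dependent_nat_choice)
    show "\<exists>x. ?P x \<and> ((0::nat) = 0 \<longrightarrow> x = ({0}, (\<lambda>_. 0), M0))"
      using M0 by (intro exI[of _ "({0}, (\<lambda>_. 0), M0)"]) simp
  next
    fix x and n :: nat
    assume x: "?P x \<and> (n = 0 \<longrightarrow> x = ({0}, (\<lambda>_. 0), M0))"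
    obtain B dg M where [simp]: "x = (B, dg, M)"
      by (cases x)
    obtain C dg' g where g: "\<And>j. finite {c \<in> C. dg' c = j}" "gr_hom C dg' B dg g"
        "M = lin_ext g ` free_module C"
      using graded_submodule_generators[of B dg M] x by auto
    show "\<exists>y. (?P y \<and> (Suc n = 0 \<longrightarrow> y = ({0}, (\<lambda>_. 0), M0))) \<and> (\<exists>g. ?R x y g)"
      using g graded_submodule_kernel[OF g(2)]
      by (intro exI[of _ "(C, dg', {x \<in> free_module C. lin_ext g x = 0})"]) auto
  qed
  then obtain s where s: "\<forall>i. (?P (s i) \<and> (i = 0 \<longrightarrow> s i = ({0}, (\<lambda>_. 0), M0))) \<and>
      (\<exists>g. ?R (s i) (s (Suc i)) g)" ..
  have P: "?P (s i)" for i
    by (rule conjunct1[OF conjunct1[OF spec[OF s]]])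
  have s0: "s 0 = ({0}, (\<lambda>_. 0), M0)"
    by (rule mp[OF conjunct2[OF conjunct1[OF spec[OF s]]] refl])
  have "\<exists>g. \<forall>i. ?R (s i) (s (Suc i)) (g i)"
    by (rule choice, rule allI, rule conjunct2[OF spec[OF s]])
  then obtain g where g: "\<forall>i. ?R (s i) (s (Suc i)) (g i)" ..
  have R: "?R (s i) (s (Suc i)) (g i)" for i
    by (rule spec[OF g])
  define F :: "('n, 'k) free_complex" where
    "F = \<lparr>gens = \<lambda>i. fst (s i), gdeg = \<lambda>i. fst (snd (s i)), aug = \<lambda>_. 1, bdry = g\<rparr>"
  have aug: "augmentation F x = lookup x 0" if "x \<in> free_module {0}" for x
  proof -
    have "augmentation F (single 0 f) = f" for f
      by (simp only: augmentation_eq lin_ext_single smult_single lookup_single_eq) (simp add: F_def)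
    then show ?thesis
      using free_module_singleton[OF that] by metis
  qed
  have "graded_free_resolution I F"
    unfolding graded_free_resolution_def
  proof (intro conjI allI ballI)
    show "finite {b \<in> gens F i. gdeg F i b = j}" for i j
      using P[of i] by (auto simp: F_def split: prod.splits)
    show "homogeneous (gdeg F 0 b) (aug F b)" if "b \<in> gens F 0" for b
      by (simp add: F_def s0 homogeneous_def)
    show "bdry F i b \<in> free_module (gens F i)"
      "homogeneous_vec (gdeg F i) (gdeg F (Suc i) b) (bdry F i b)" if "b \<in> gens F (Suc i)" for i b
      using R[of i] that by (auto simp: F_def gr_hom_def split: prod.splits)
    show "\<exists>x\<in>free_module (gens F 0). r - augmentation F x \<in> I" for r
    proof
      show "single 0 r \<in> free_module (gens F 0)"
        by (simp add: F_def s0 free_module_single)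
      show "r - augmentation F (single 0 r) \<in> I"
        by (simp add: aug free_module_single ideal_0[OF I(1)])
    qed
    have "{x \<in> free_module (gens F 0). augmentation F x \<in> I} = M0"
      using aug by (auto simp: F_def s0 M0_def)
    then show "{x \<in> free_module (gens F 0). augmentation F x \<in> I} =
        differential F 0 ` free_module (gens F (Suc 0))"
      using R[of 0] by (auto simp: F_def s0 differential_def split: prod.splits)
    show "{x \<in> free_module (gens F (Suc i)). differential F i x = 0} =
        differential F (Suc i) ` free_module (gens F (Suc (Suc i)))" for i
      using R[of i] R[of "Suc i"] by (auto simp: F_def differential_def split: prod.splits)
  qed
  then show ?thesis ..
qed

section \<open>Comparison of resolutions\<close>

text \<open>At index \<open>0\<close> the kernel is taken modulo \<open>I\<close>. With this
  convention exactness has the same form at every index, and the inductions along a resolution need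
  no separate treatment of the augmentation.\<close>

fun res_cycles :: "('n::finite, 'k::field) mpoly set \<Rightarrow> ('n, 'k) free_complex \<Rightarrow> nat \<Rightarrow>
    (nat \<Rightarrow>\<^sub>0 ('n, 'k) mpoly) set" where
  "res_cycles I F 0 = {x \<in> free_module (gens F 0). augmentation F x \<in> I}"
| "res_cycles I F (Suc i) = {x \<in> free_module (gens F (Suc i)). differential F i x = 0}"

abbreviation hom_on :: "('n::finite, 'k::field) free_complex \<Rightarrow> nat \<Rightarrow> ('n, 'k) free_complex \<Rightarrow> nat \<Rightarrow>
    (nat \<Rightarrow> (nat \<Rightarrow>\<^sub>0 ('n, 'k) mpoly)) \<Rightarrow> bool" where
  "hom_on F i G k \<equiv> gr_hom (gens F i) (gdeg F i) (gens G k) (gdeg G k)"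

lemma resolution_exact:
  assumes "graded_free_resolution I F"
  shows "res_cycles I F i = differential F i ` free_module (gens F (Suc i))"
  using assms by (cases i) (auto simp: graded_free_resolution_def)

lemma resolution_hom: "graded_free_resolution I F \<Longrightarrow> hom_on F (Suc i) F i (bdry F i)"
  by (simp add: graded_free_resolution_def gr_hom_def)

lemma differential_in_res_cycles:
  assumes "graded_free_resolution I F" "x \<in> free_module (gens F (Suc i))"
  shows "differential F i x \<in> res_cycles I F i"
  using assms by (simp add: resolution_exact)

lemma differential_differential:
  assumes "graded_free_resolution I F" "x \<in> free_module (gens F (Suc (Suc i)))"
  shows "differential F i (differential F (Suc i) x) = 0"
  using differential_in_res_cycles[OF assms] by simp

lemma gr_hom_comp:
  assumes "gr_hom B dg C dg' f" "gr_hom C dg' D dg'' g"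
  shows "gr_hom B dg D dg'' (\<lambda>b. lin_ext g (f b))"
  using assms(1) gr_hom_free_module[OF assms(2)] gr_hom_homogeneous_vec[OF assms(2)]
  by (simp add: gr_hom_def)

lemma gr_hom_diff:
  "gr_hom B dg C dg' f \<Longrightarrow> gr_hom B dg C dg' g \<Longrightarrow> gr_hom B dg C dg' (\<lambda>b. f b - g b)"
  by (simp add: gr_hom_def free_module_diff homogeneous_vec_diff)

lemma gr_hom_id: "gr_hom B dg B dg (\<lambda>b. single b 1)"
  by (simp add: gr_hom_def free_module_single lookup_one)

text \<open>Free modules are projective: preimages are chosen for the basis elements and extended
  linearly. To keep the lift graded, each preimage is replaced by its component of degree
  \<open>dg b\<close>, which still maps to \<open>f b\<close> because \<open>f b\<close> is
  homogeneous.\<close>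

lemma gr_hom_lift:
  assumes f: "gr_hom B dg C dgC f" and \<delta>: "gr_hom C' dgC' C dgC \<delta>"
    and im: "\<And>b. b \<in> B \<Longrightarrow> f b \<in> lin_ext \<delta> ` free_module C'"
  shows "\<exists>h. gr_hom B dg C' dgC' h \<and> (\<forall>x\<in>free_module B. lin_ext \<delta> (lin_ext h x) = lin_ext f x)"
proof -
  have "\<exists>y. y \<in> free_module C' \<and> homogeneous_vec dgC' (dg b) y \<and> lin_ext \<delta> y = f b" if b: "b \<in> B" for b
  proof -
    obtain y where y: "y \<in> free_module C'" "f b = lin_ext \<delta> y"
      using im[OF b] by blast
    have "lin_ext \<delta> (hcomp dgC' (dg b) y) = hcomp dgC (dg b) (f b)"
      using hcomp_lin_ext[OF \<delta> y(1)] y(2) by simp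
    also have "\<dots> = f b"
      using f b hcomp_homogeneous_vec[of dgC "dg b" "f b" "dg b"] by (simp add: gr_hom_def)
    finally show ?thesis
      using y(1) hcomp_free_module homogeneous_vec_hcomp by blast
  qed
  then obtain h where h: "\<And>b. b \<in> B \<Longrightarrow> h b \<in> free_module C'"
      "\<And>b. b \<in> B \<Longrightarrow> homogeneous_vec dgC' (dg b) (h b)" "\<And>b. b \<in> B \<Longrightarrow> lin_ext \<delta> (h b) = f b"
    by metis
  have "lin_ext \<delta> (lin_ext h x) = lin_ext f x" if "x \<in> free_module B" for x
    unfolding lin_ext_lin_ext by (rule lin_ext_cong) (use that h(3) in \<open>auto simp: free_module_def\<close>)
  with h show ?thesis
    by (intro exI[of _ h]) (simp add: gr_hom_def)
qed

lemma augmentation_diff: "augmentation F (x - y) = augmentation F x - augmentation F y"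
  by (simp add: augmentation_eq lin_ext_diff lookup_minus)

lemma hpart_augmentation:
  assumes "graded_free_resolution I F" "x \<in> free_module (gens F 0)"
  shows "hpart d (augmentation F x) = augmentation F (hcomp (gdeg F 0) d x)"
proof -
  have "gr_hom (gens F 0) (gdeg F 0) {0} (\<lambda>_. 0) (\<lambda>b. single 0 (aug F b))"
    using assms(1) by (auto simp: graded_free_resolution_def gr_hom_def free_module_single homogeneous_iff)
  from arg_cong[OF hcomp_lin_ext[OF this assms(2), of d], of "\<lambda>v. lookup v 0"] show ?thesis
    unfolding augmentation_eq by (simp add: lookup_hcomp)
qed

text \<open>The base case of the comparison theorem. Surjectivity onto the quotient yields preimages
  modulo \<open>I\<close>; passing to components keeps the error in \<open>I\<close> since
  \<open>I\<close> is graded.\<close>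

lemma augmentation_lift:
  assumes I: "graded_ideal I" and F: "graded_free_resolution I F" and G: "graded_free_resolution I G"
  shows "\<exists>\<phi>. hom_on F 0 G 0 \<phi> \<and>
    (\<forall>x\<in>free_module (gens F 0). augmentation F x - augmentation G (lin_ext \<phi> x) \<in> I)"
proof -
  have sub: "module.subspace (*) I"
    using I by (simp add: graded_ideal_def)
  have "\<exists>y. y \<in> free_module (gens G 0) \<and> homogeneous_vec (gdeg G 0) (gdeg F 0 b) y \<and>
      aug F b - augmentation G y \<in> I" if b: "b \<in> gens F 0" for b
  proof -
    have "\<forall>r. \<exists>y\<in>free_module (gens G 0). r - augmentation G y \<in> I"
      using G by (simp add: graded_free_resolution_def)
    then obtain y where y: "y \<in> free_module (gens G 0)" "aug F b - augmentation G y \<in> I"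
      by blast
    let ?y = "hcomp (gdeg G 0) (gdeg F 0 b) y"
    have "homogeneous (gdeg F 0 b) (aug F b)"
      using F b by (simp add: graded_free_resolution_def)
    then have "hpart (gdeg F 0 b) (aug F b) = aug F b"
      by (intro poly_mapping_eqI) (auto simp: homogeneous_iff when_def)
    then have "aug F b - augmentation G ?y = hpart (gdeg F 0 b) (aug F b - augmentation G y)"
      by (simp add: additive.diff[OF additive_hpart] hpart_augmentation[OF G y(1)])
    also have "\<dots> \<in> I"
      using I y(2) by (simp add: graded_ideal_def)
    finally show ?thesis
      using y(1) hcomp_free_module homogeneous_vec_hcomp by blast
  qed
  then obtain \<phi> where \<phi>: "\<And>b. b \<in> gens F 0 \<Longrightarrow> \<phi> b \<in> free_module (gens G 0)"
      "\<And>b. b \<in> gens F 0 \<Longrightarrow> homogeneous_vec (gdeg G 0) (gdeg F 0 b) (\<phi> b)"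
      "\<And>b. b \<in> gens F 0 \<Longrightarrow> aug F b - augmentation G (\<phi> b) \<in> I"
    by metis
  have "augmentation F x - augmentation G (lin_ext \<phi> x) \<in> I" if "x \<in> free_module (gens F 0)" for x
  proof -
    have "augmentation F x - augmentation G (lin_ext \<phi> x) =
        (\<Sum>b\<in>keys x. lookup x b * (aug F b - augmentation G (\<phi> b)))"
      by (simp add: augmentation_eq lin_ext_lin_ext lookup_lin_ext sum_subtractf right_diff_distrib)
    also have "\<dots> \<in> I"
      by (intro ideal_sum[OF sub] ideal_mult[OF sub] \<phi>(3)) (use that in \<open>auto simp: free_module_def\<close>)
    finally show ?thesis .
  qed
  with \<phi> show ?thesis
    by (intro exI[of _ \<phi>]) (simp add: gr_hom_def)
qed

text \<open>The comparison theorem: a chain map over the identity of the quotient is built by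
  lifting through the exact complex \<open>G\<close>, one index at a time.\<close>

lemma comparison_map:
  assumes I: "graded_ideal I" and F: "graded_free_resolution I F" and G: "graded_free_resolution I G"
  obtains \<phi> where "\<And>i. hom_on F i G i (\<phi> i)"
    "\<And>x. x \<in> free_module (gens F 0) \<Longrightarrow> augmentation F x - augmentation G (lin_ext (\<phi> 0) x) \<in> I"
    "\<And>i x. x \<in> free_module (gens F (Suc i)) \<Longrightarrow>
       differential G i (lin_ext (\<phi> (Suc i)) x) = lin_ext (\<phi> i) (differential F i x)"
proof -
  have sub: "module.subspace (*) I"
    using I by (simp add: graded_ideal_def)
  \<comment> \<open>The induction also carries that cycles go to cycles: this puts
    \<open>\<phi>\<close> of a boundary into the image of the next differential of \<open>G\<close>,
    where it can be lifted.\<close>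
  let ?P = "\<lambda>i \<phi>. hom_on F i G i \<phi> \<and> (\<forall>x\<in>res_cycles I F i. lin_ext \<phi> x \<in> res_cycles I G i) \<and>
    (i = 0 \<longrightarrow> (\<forall>x\<in>free_module (gens F 0). augmentation F x - augmentation G (lin_ext \<phi> x) \<in> I))"
  let ?Q = "\<lambda>i \<phi> \<phi>'. \<forall>x\<in>free_module (gens F (Suc i)).
    differential G i (lin_ext \<phi>' x) = lin_ext \<phi> (differential F i x)"
  have "\<exists>\<phi>. \<forall>i. ?P i (\<phi> i) \<and> ?Q i (\<phi> i) (\<phi> (Suc i))"
  proof (rule dependent_nat_choice)
    obtain \<phi> where \<phi>: "hom_on F 0 G 0 \<phi>"
      "\<And>x. x \<in> free_module (gens F 0) \<Longrightarrow> augmentation F x - augmentation G (lin_ext \<phi> x) \<in> I"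
      using augmentation_lift[OF I F G] by blast
    have "lin_ext \<phi> x \<in> res_cycles I G 0" if "x \<in> res_cycles I F 0" for x
    proof -
      have "augmentation F x - (augmentation F x - augmentation G (lin_ext \<phi> x)) \<in> I"
        using that by (intro ideal_diff[OF sub _ \<phi>(2)]) auto
      then show ?thesis
        using that gr_hom_free_module[OF \<phi>(1)] by simp
    qed
    with \<phi> show "\<exists>\<phi>. ?P 0 \<phi>"
      by blast
  next
    fix \<phi> i
    assume P: "?P i \<phi>"
    let ?f = "\<lambda>b. lin_ext \<phi> (bdry F i b)"
    have f: "hom_on F (Suc i) G i ?f"
      using P by (intro gr_hom_comp[OF resolution_hom[OF F]]) simp
    have "?f b \<in> lin_ext (bdry G i) ` free_module (gens G (Suc i))" if b: "b \<in> gens F (Suc i)" for b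
    proof -
      have "differential F i (single b 1) \<in> res_cycles I F i"
        using b by (intro differential_in_res_cycles[OF F] free_module_single)
      then have "?f b \<in> res_cycles I G i"
        using P by (simp add: differential_def)
      then show ?thesis
        by (simp add: resolution_exact[OF G] differential_def)
    qed
    from gr_hom_lift[OF f resolution_hom[OF G] this] obtain \<phi>' where \<phi>': "hom_on F (Suc i) G (Suc i) \<phi>'"
      "\<And>x. x \<in> free_module (gens F (Suc i)) \<Longrightarrow> lin_ext (bdry G i) (lin_ext \<phi>' x) = lin_ext ?f x"
      by blast
    then have Q: "?Q i \<phi> \<phi>'"
      by (simp add: differential_def lin_ext_lin_ext)
    then have "?P (Suc i) \<phi>'"
      using \<phi>'(1) gr_hom_free_module[OF \<phi>'(1)] by simp
    with Q show "\<exists>\<phi>'. ?P (Suc i) \<phi>' \<and> ?Q i \<phi> \<phi>'"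
      by blast
  qed
  then obtain \<phi> where "\<forall>i. ?P i (\<phi> i) \<and> ?Q i (\<phi> i) (\<phi> (Suc i))" ..
  then show thesis
    by (intro that[of \<phi>]) auto
qed

text \<open>By \<open>\<theta>0\<close> the chain map \<open>\<theta>\<close> covers zero on the
  quotient, so the homotopy can be found by successive lifting.\<close>

lemma null_homotopy:
  assumes F: "graded_free_resolution I F" and \<theta>: "\<And>i. hom_on F i F i (\<theta> i)"
    and \<theta>0: "\<And>x. x \<in> free_module (gens F 0) \<Longrightarrow> lin_ext (\<theta> 0) x \<in> res_cycles I F 0"
    and comm: "\<And>i x. x \<in> free_module (gens F (Suc i)) \<Longrightarrow>
      differential F i (lin_ext (\<theta> (Suc i)) x) = lin_ext (\<theta> i) (differential F i x)"
  obtains h where "\<And>i. hom_on F i F (Suc i) (h i)"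
    "\<And>x. x \<in> free_module (gens F 0) \<Longrightarrow> differential F 0 (lin_ext (h 0) x) = lin_ext (\<theta> 0) x"
    "\<And>i x. x \<in> free_module (gens F (Suc i)) \<Longrightarrow>
       differential F (Suc i) (lin_ext (h (Suc i)) x) =
         lin_ext (\<theta> (Suc i)) x - lin_ext (h i) (differential F i x)"
proof -
  \<comment> \<open>On cycles the term with the previous homotopy vanishes, so there the homotopy
    equation mentions \<open>h\<close> alone. This is the invariant that makes the next map to be
    lifted take values in cycles.\<close>
  let ?P = "\<lambda>i h. hom_on F i F (Suc i) h \<and>
    (\<forall>x\<in>res_cycles I F i. differential F i (lin_ext h x) = lin_ext (\<theta> i) x) \<and>
    (i = 0 \<longrightarrow> (\<forall>x\<in>free_module (gens F 0). differential F 0 (lin_ext h x) = lin_ext (\<theta> 0) x))"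
  let ?Q = "\<lambda>i h h'. \<forall>x\<in>free_module (gens F (Suc i)).
    differential F (Suc i) (lin_ext h' x) = lin_ext (\<theta> (Suc i)) x - lin_ext h (differential F i x)"
  have "\<exists>h. \<forall>i. ?P i (h i) \<and> ?Q i (h i) (h (Suc i))"
  proof (rule dependent_nat_choice)
    have "\<theta> 0 b \<in> lin_ext (bdry F 0) ` free_module (gens F (Suc 0))" if b: "b \<in> gens F 0" for b
      using \<theta>0[OF free_module_single[OF b, of 1]]
      unfolding resolution_exact[OF F] by (simp add: differential_def)
    from gr_hom_lift[OF \<theta> resolution_hom[OF F] this] show "\<exists>h. ?P 0 h"
      by (auto simp: differential_def)
  next
    fix h i
    assume P: "?P i h"
    let ?f = "\<lambda>b. \<theta> (Suc i) b - lin_ext h (bdry F i b)"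
    have f: "hom_on F (Suc i) F (Suc i) ?f"
      using P by (intro gr_hom_diff \<theta> gr_hom_comp[OF resolution_hom[OF F]]) simp
    have lin: "lin_ext ?f x = lin_ext (\<theta> (Suc i)) x - lin_ext h (differential F i x)" for x
      by (simp add: lin_ext_diff_fun lin_ext_lin_ext differential_def)
    have "?f b \<in> lin_ext (bdry F (Suc i)) ` free_module (gens F (Suc (Suc i)))"
      if b: "b \<in> gens F (Suc i)" for b
    proof -
      have x: "single b 1 \<in> free_module (gens F (Suc i))"
        by (rule free_module_single) fact
      have "differential F i (lin_ext ?f (single b 1)) = 0"
        unfolding lin using P comm[OF x] differential_in_res_cycles[OF F x]
        by (simp add: differential_def[of F i] lin_ext_diff)
      then have "?f b \<in> res_cycles I F (Suc i)"
        using gr_hom_free_module[OF f x] by simp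
      then show ?thesis
        unfolding resolution_exact[OF F] by (simp add: differential_def)
    qed
    from gr_hom_lift[OF f resolution_hom[OF F] this] obtain h' where
      h': "hom_on F (Suc i) F (Suc (Suc i)) h'"
      "\<And>x. x \<in> free_module (gens F (Suc i)) \<Longrightarrow>
         lin_ext (bdry F (Suc i)) (lin_ext h' x) = lin_ext ?f x"
      by blast
    then have Q: "?Q i h h'"
      unfolding lin by (simp add: differential_def)
    then have "?P (Suc i) h'"
      using h'(1) by simp
    with Q show "\<exists>h'. ?P (Suc i) h' \<and> ?Q i h h'"
      by blast
  qed
  then obtain h where "\<forall>i. ?P i (h i) \<and> ?Q i (h i) (h (Suc i))" ..
  then show thesis
    by (intro that[of h]) auto
qed

section \<open>Vanishing of Tor\<close>

abbreviation bar :: "(nat \<Rightarrow>\<^sub>0 ('n::finite, 'k::field) mpoly) \<Rightarrow> (nat \<Rightarrow>\<^sub>0 'k)" where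
  "bar \<equiv> Poly_Mapping.map const_coeff"

text \<open>A sum of two exponent vectors is zero only if both are, so a single product contributes
  to the constant term.\<close>

lemma const_coeff_mult:
  fixes f g :: "('n, 'k::comm_ring_1) mpoly"
  shows "const_coeff (f * g) = const_coeff f * const_coeff g"
proof -
  have "0 = l + q \<longleftrightarrow> q = 0 \<and> l = 0" for l q :: "'n \<Rightarrow>\<^sub>0 nat"
    by (auto simp: poly_mapping_eq_iff fun_eq_iff lookup_add)
  then have "(lookup g q when 0 = l + q) = ((lookup g q when q = 0) when l = 0)" for l q :: "'n \<Rightarrow>\<^sub>0 nat"
    by (simp add: when_def)
  then show ?thesis
    by (simp add: const_coeff_def lookup_mult Sum_any_when_independent mult_when)
qed

lemma additive_const_coeff: "additive (const_coeff :: ('n, 'k::comm_ring_1) mpoly \<Rightarrow> 'k)"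
  by (rule additiveI) (simp add: const_coeff_def lookup_add)

lemma const_coeff_0 [simp]: "const_coeff 0 = 0"
  by (simp add: const_coeff_def)

lemma const_coeff_single_0 [simp]: "const_coeff (single 0 c) = c"
  by (simp add: const_coeff_def)

lemma bar_lin_ext: "bar (lin_ext f x) = lin_ext (\<lambda>b. bar (f b)) (bar x)"
  by (rule map_lin_ext_hom[OF additive_const_coeff const_coeff_mult])

lemma bar_diff: "bar (x - y) = bar x - bar y"
  by (rule poly_mapping_eqI) (simp add: lookup_map lookup_minus additive.diff[OF additive_const_coeff])

lemma bar_0 [simp]: "bar 0 = 0"
  by (rule poly_mapping_eqI) (simp add: lookup_map)

lemma bar_map_single [simp]: "bar (Poly_Mapping.map (single 0) x) = x"
  by (rule poly_mapping_eqI) (simp add: lookup_map)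

lemma bar_differential: "bar (differential F i x) = tensor_differential F i (bar x)"
  by (simp add: differential_def tensor_differential_def bar_lin_ext)

lemma additive_tensor_differential: "additive (tensor_differential F i)"
  unfolding tensor_differential_def by (rule additive_lin_ext)

text \<open>The entry of a graded matrix from \<open>b\<close> to \<open>c\<close> has degree
  \<open>dg b - dg' c\<close>. Its constant coefficient can be nonzero only if the two degrees
  agree, so the reduced matrix respects internal degrees.\<close>

lemma bar_hom_degree:
  assumes "gr_hom B dg C dg' f" "x \<in> free_module {b \<in> B. dg b = j}"
  shows "lin_ext (\<lambda>b. bar (f b)) x \<in> free_module {c \<in> C. dg' c = j}"
proof (rule free_module_lin_ext[OF assms(2)])
  fix b assume b: "b \<in> {b \<in> B. dg b = j}"
  then have "f b \<in> free_module C" "homogeneous_vec dg' j (f b)"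
    using assms(1) by (auto simp: gr_hom_def)
  then show "bar (f b) \<in> free_module {c \<in> C. dg' c = j}"
    unfolding free_module_iff homogeneous_vec_iff
    by (auto simp: lookup_map const_coeff_def) (metis lookup_zero, metis add_0 mon_deg_0)
qed

section \<open>Chain maps and Tor\<close>

lemma tor_cycles_subset: "tor_cycles F i j \<subseteq> tensor_component F i j"
  by (cases i) auto

lemma tensor_component_lift:
  "x \<in> tensor_component F i j \<Longrightarrow> Poly_Mapping.map (single 0) x \<in> free_module (gens F i)"
  by (rule free_module_map) (auto simp: tensor_component_def free_module_def)

lemma chain_map_tor_cycles:
  fixes F G :: "('n::finite, 'k::field) free_complex"
  assumes \<phi>: "\<And>i. hom_on F i G i (\<phi> i)"
    and comm: "\<And>i x. x \<in> free_module (gens F (Suc i)) \<Longrightarrow>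
       differential G i (lin_ext (\<phi> (Suc i)) x) = lin_ext (\<phi> i) (differential F i x)"
    and x: "x \<in> tor_cycles F i j"
  shows "lin_ext (\<lambda>b. bar (\<phi> i b)) x \<in> tor_cycles G i j"
proof -
  have "lin_ext (\<lambda>b. bar (\<phi> i b)) x \<in> tensor_component G i j"
    using bar_hom_degree[OF \<phi>] x tor_cycles_subset unfolding tensor_component_def by blast
  moreover have "tensor_differential G k (lin_ext (\<lambda>b. bar (\<phi> (Suc k) b)) x) = 0" if "i = Suc k" for k
  proof -
    \<comment> \<open>The vector is lifted to constant polynomials, the commutation rule is applied
      there, and \<open>bar\<close> brings the equation back to the field.\<close>
    let ?X = "Poly_Mapping.map (single 0) x :: nat \<Rightarrow>\<^sub>0 ('n, 'k) mpoly"
    have "bar (differential G k (lin_ext (\<phi> (Suc k)) ?X)) = bar (lin_ext (\<phi> k) (differential F k ?X))"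
      using comm[of ?X k] tensor_component_lift[of x F i j] x tor_cycles_subset that by fastforce
    then show ?thesis
      using x that by (simp add: bar_differential bar_lin_ext)
  qed
  ultimately show ?thesis
    by (cases i) auto
qed

lemma chain_map_tor_boundaries:
  fixes F G :: "('n::finite, 'k::field) free_complex"
  assumes \<phi>: "\<And>i. hom_on F i G i (\<phi> i)"
    and comm: "\<And>i x. x \<in> free_module (gens F (Suc i)) \<Longrightarrow>
       differential G i (lin_ext (\<phi> (Suc i)) x) = lin_ext (\<phi> i) (differential F i x)"
    and x: "x \<in> tor_boundaries F i j"
  shows "lin_ext (\<lambda>b. bar (\<phi> i b)) x \<in> tor_boundaries G i j"
proof -
  obtain y where y: "y \<in> tensor_component F (Suc i) j" "x = tensor_differential F i y"
    using x by (auto simp: tor_boundaries_def)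
  let ?Y = "Poly_Mapping.map (single 0) y :: nat \<Rightarrow>\<^sub>0 ('n, 'k) mpoly"
  have "bar (lin_ext (\<phi> i) (differential F i ?Y)) = bar (differential G i (lin_ext (\<phi> (Suc i)) ?Y))"
    using comm[OF tensor_component_lift[OF y(1)]] by simp
  then have "lin_ext (\<lambda>b. bar (\<phi> i b)) x = tensor_differential G i (lin_ext (\<lambda>b. bar (\<phi> (Suc i) b)) y)"
    using y(2) by (simp add: bar_differential bar_lin_ext)
  moreover have "lin_ext (\<lambda>b. bar (\<phi> (Suc i) b)) y \<in> tensor_component G (Suc i) j"
    using bar_hom_degree[OF \<phi>] y(1) unfolding tensor_component_def by blast
  ultimately show ?thesis
    by (auto simp: tor_boundaries_def)
qed

text \<open>A cycle of \<open>F\<close> is sent to \<open>G\<close>, where it becomes a boundary,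
  and then back to \<open>F\<close>. The round trip changes it only by a boundary, because the
  composite chain map is homotopic to the identity.\<close>

lemma tor_vanishing_independent:
  fixes F G :: "('n::finite, 'k::field) free_complex"
  assumes I: "graded_ideal I" and F: "graded_free_resolution I F" and G: "graded_free_resolution I G"
    and van: "tor_cycles G i j \<subseteq> tor_boundaries G i j"
  shows "tor_cycles F i j \<subseteq> tor_boundaries F i j"
proof
  fix x assume x: "x \<in> tor_cycles F i j"
  have sub: "module.subspace (*) I"
    using I by (simp add: graded_ideal_def)
  obtain \<phi> where \<phi>: "\<And>i. hom_on F i G i (\<phi> i)"
    "\<And>x. x \<in> free_module (gens F 0) \<Longrightarrow> augmentation F x - augmentation G (lin_ext (\<phi> 0) x) \<in> I"
    "\<And>i x. x \<in> free_module (gens F (Suc i)) \<Longrightarrow>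
       differential G i (lin_ext (\<phi> (Suc i)) x) = lin_ext (\<phi> i) (differential F i x)"
    using comparison_map[OF I F G] by metis
  obtain \<psi> where \<psi>: "\<And>i. hom_on G i F i (\<psi> i)"
    "\<And>x. x \<in> free_module (gens G 0) \<Longrightarrow> augmentation G x - augmentation F (lin_ext (\<psi> 0) x) \<in> I"
    "\<And>i x. x \<in> free_module (gens G (Suc i)) \<Longrightarrow>
       differential F i (lin_ext (\<psi> (Suc i)) x) = lin_ext (\<psi> i) (differential G i x)"
    using comparison_map[OF I G F] by metis
  \<comment> \<open>The round trip minus the identity covers zero on the quotient, since both
    comparison maps preserve the augmentation modulo \<open>I\<close>; hence it is
    null-homotopic.\<close>
  define \<theta> where "\<theta> i b = lin_ext (\<psi> i) (\<phi> i b) - single b 1" for i b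
  have \<theta>_lin: "lin_ext (\<theta> i) x = lin_ext (\<psi> i) (lin_ext (\<phi> i) x) - x" for i x
    by (simp add: \<theta>_def[abs_def] lin_ext_diff_fun lin_ext_lin_ext)
  have \<theta>: "hom_on F i F i (\<theta> i)" for i
    unfolding \<theta>_def by (intro gr_hom_diff gr_hom_comp[OF \<phi>(1) \<psi>(1)] gr_hom_id)
  have \<theta>0: "lin_ext (\<theta> 0) x \<in> res_cycles I F 0" if x: "x \<in> free_module (gens F 0)" for x
  proof -
    let ?y = "lin_ext (\<phi> 0) x"
    have "- (augmentation F x - augmentation G ?y) - (augmentation G ?y - augmentation F (lin_ext (\<psi> 0) ?y)) \<in> I"
      using ideal_diff[OF sub ideal_diff[OF sub ideal_0[OF sub] \<phi>(2)[OF x]]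
        \<psi>(2)[OF gr_hom_free_module[OF \<phi>(1) x]]] by simp
    then have "augmentation F (lin_ext (\<theta> 0) x) \<in> I"
      by (simp add: \<theta>_lin augmentation_diff)
    then show ?thesis
      using gr_hom_free_module[OF \<theta> x] by simp
  qed
  have \<theta>_comm: "differential F i (lin_ext (\<theta> (Suc i)) x) = lin_ext (\<theta> i) (differential F i x)"
    if x: "x \<in> free_module (gens F (Suc i))" for i x
  proof -
    have "differential F i (lin_ext (\<theta> (Suc i)) x) =
        differential F i (lin_ext (\<psi> (Suc i)) (lin_ext (\<phi> (Suc i)) x)) - differential F i x"
      by (simp add: \<theta>_lin differential_def lin_ext_diff)
    also have "\<dots> = lin_ext (\<theta> i) (differential F i x)"
      by (simp add: \<theta>_lin \<psi>(3)[OF gr_hom_free_module[OF \<phi>(1) x]] \<phi>(3)[OF x])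
    finally show ?thesis .
  qed
  obtain h where h: "\<And>i. hom_on F i F (Suc i) (h i)"
    "\<And>x. x \<in> free_module (gens F 0) \<Longrightarrow> differential F 0 (lin_ext (h 0) x) = lin_ext (\<theta> 0) x"
    "\<And>i x. x \<in> free_module (gens F (Suc i)) \<Longrightarrow>
       differential F (Suc i) (lin_ext (h (Suc i)) x) =
         lin_ext (\<theta> (Suc i)) x - lin_ext (h i) (differential F i x)"
    using null_homotopy[OF F \<theta> \<theta>0 \<theta>_comm] by metis
  let ?X = "Poly_Mapping.map (single 0) x :: nat \<Rightarrow>\<^sub>0 ('n, 'k) mpoly"
  let ?y = "lin_ext (\<lambda>b. bar (\<psi> i b)) (lin_ext (\<lambda>b. bar (\<phi> i b)) x)"
  let ?z = "lin_ext (\<lambda>b. bar (h i b)) x"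
  have x': "x \<in> tensor_component F i j"
    using x tor_cycles_subset by blast
  have X: "?X \<in> free_module (gens F i)"
    by (rule tensor_component_lift[OF x'])
  \<comment> \<open>The homotopy term through the previous index disappears after reduction: the
    reduced differential annihilates the cycle \<open>x\<close>.\<close>
  have "bar (differential F i (lin_ext (h i) ?X)) = bar (lin_ext (\<theta> i) ?X)"
  proof (cases i)
    case 0
    then show ?thesis
      using h(2) X by simp
  next
    case (Suc k)
    then have "bar (lin_ext (h k) (differential F k ?X)) = 0"
      using x by (simp add: bar_lin_ext bar_differential)
    then show ?thesis
      using h(3)[of ?X k] X Suc by (simp add: bar_diff)
  qed
  then have z: "tensor_differential F i ?z = ?y - x"
    by (simp add: bar_differential bar_lin_ext \<theta>_lin bar_diff)
  have "?y \<in> tor_boundaries F i j"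
    using chain_map_tor_boundaries[OF \<psi>(1,3)] chain_map_tor_cycles[OF \<phi>(1,3) x] van by blast
  then obtain w where w: "w \<in> tensor_component F (Suc i) j" "?y = tensor_differential F i w"
    by (auto simp: tor_boundaries_def)
  have "x = tensor_differential F i (w - ?z)"
    using z w(2) by (simp add: additive.diff[OF additive_tensor_differential])
  moreover have "w - ?z \<in> tensor_component F (Suc i) j"
    using w(1) bar_hom_degree[OF h(1)] x' unfolding tensor_component_def by (blast intro: free_module_diff)
  ultimately show "x \<in> tor_boundaries F i j"
    by (auto simp: tor_boundaries_def)
qed

text \<open>A vanishing truncated difference only says \<open>coord.dim Z \<le> coord.dim B\<close>.
  An element of \<open>Z\<close> outside \<open>B\<close> would extend a basis of \<open>B\<close>
  to an independent set larger than a basis of \<open>Z\<close>. The finite spanning set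
  \<open>T\<close> rules out infinite bases, whose \<open>card\<close> would be
  \<open>0\<close>.\<close>

lemma dim_diff_eq_0_iff:
  fixes Z B :: "(nat \<Rightarrow>\<^sub>0 'k::field) set"
  assumes "B \<subseteq> Z" "free.subspace B" "Z \<subseteq> free.span T" "finite T"
  shows "coord.dim Z - coord.dim B = 0 \<longleftrightarrow> Z \<subseteq> B"
proof
  assume "Z \<subseteq> B"
  then show "coord.dim Z - coord.dim B = 0"
    using assms(1) by simp
next
  assume le: "coord.dim Z - coord.dim B = 0"
  obtain S where S: "S \<subseteq> B" "free.independent S" "B \<subseteq> free.span S" "card S = coord.dim B"
    by (rule coord.basis_exists)
  obtain S' where S': "S' \<subseteq> Z" "free.independent S'" "Z \<subseteq> free.span S'" "card S' = coord.dim Z"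
    by (rule coord.basis_exists)
  have "finite S'"
    using coord.independent_span_bound[OF assms(4) S'(2)] S'(1) assms(3) by (meson order_trans)
  show "Z \<subseteq> B"
  proof
    fix z assume z: "z \<in> Z"
    show "z \<in> B"
    proof (rule ccontr)
      assume "z \<notin> B"
      have "free.span S \<subseteq> B"
        by (rule free.span_minimal[OF S(1) assms(2)])
      then have z': "z \<notin> free.span S" "z \<notin> S"
        using \<open>z \<notin> B\<close> S(1) by auto
      then have "free.independent (insert z S)"
        using S(2) by (simp add: coord.independent_insert)
      moreover have "insert z S \<subseteq> free.span S'"
        using z S(1) assms(1) S'(3) by blast
      ultimately have fin: "finite (insert z S)" "card (insert z S) \<le> card S'"
        using coord.independent_span_bound[OF \<open>finite S'\<close>, of "insert z S"] by simp_all
      then have "Suc (card S) \<le> card S'"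
        using z'(2) by simp
      with le S(4) S'(4) show False
        by simp
    qed
  qed
qed

lemma tor_boundaries_subset_cycles:
  fixes F :: "('n::finite, 'k::field) free_complex"
  assumes F: "graded_free_resolution I F"
  shows "tor_boundaries F i j \<subseteq> tor_cycles F i j"
proof
  fix x assume "x \<in> tor_boundaries F i j"
  then obtain y where y: "y \<in> tensor_component F (Suc i) j" "x = tensor_differential F i y"
    by (auto simp: tor_boundaries_def)
  have "x \<in> tensor_component F i j"
    using bar_hom_degree[OF resolution_hom[OF F]] y by (simp add: tensor_component_def tensor_differential_def)
  moreover have "tensor_differential F k x = 0" if "i = Suc k" for k
  proof -
    let ?Y = "Poly_Mapping.map (single 0) y :: nat \<Rightarrow>\<^sub>0 ('n, 'k) mpoly"
    have "?Y \<in> free_module (gens F (Suc (Suc k)))"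
      using tensor_component_lift[OF y(1)] that by blast
    from differential_differential[OF F this]
    have "bar (differential F k (differential F (Suc k) ?Y)) = 0"
      by simp
    then show ?thesis
      using y(2) that by (simp add: bar_differential)
  qed
  ultimately show "x \<in> tor_cycles F i j"
    by (cases i) auto
qed

lemma subspace_tor_boundaries: "free.subspace (tor_boundaries F i j)"
proof (rule free.subspaceI)
  show "0 \<in> tor_boundaries F i j"
    unfolding tor_boundaries_def tensor_component_def tensor_differential_def
    by (rule image_eqI[of _ _ 0]) simp_all
  show "x + y \<in> tor_boundaries F i j" if "x \<in> tor_boundaries F i j" "y \<in> tor_boundaries F i j" for x y
    using that unfolding tor_boundaries_def tensor_component_def tensor_differential_def
    by (auto simp flip: lin_ext_add intro: free_module_add)
  show "smult c x \<in> tor_boundaries F i j" if "x \<in> tor_boundaries F i j" for c x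
    using that unfolding tor_boundaries_def tensor_component_def tensor_differential_def
    by (auto simp flip: lin_ext_smult intro: free_module_smult)
qed

lemma free_module_span: "free_module A \<subseteq> free.span ((\<lambda>b. single b (1::'k::field)) ` A)"
proof
  fix x :: "nat \<Rightarrow>\<^sub>0 'k" assume x: "x \<in> free_module A"
  have "lin_ext (\<lambda>b. single b 1) x \<in> free.span ((\<lambda>b. single b 1) ` A)"
    unfolding lin_ext_def
    by (intro free.span_sum free.span_scale free.span_base) (use x in \<open>auto simp: free_module_def\<close>)
  then show "x \<in> free.span ((\<lambda>b. single b 1) ` A)"
    by simp
qed

lemma tor_dim_eq_0_iff:
  assumes F: "graded_free_resolution I F"
  shows "tor_dim F i j = 0 \<longleftrightarrow> tor_cycles F i j \<subseteq> tor_boundaries F i j"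
  unfolding tor_dim_def
proof (rule dim_diff_eq_0_iff)
  let ?A = "{b \<in> gens F i. gdeg F i b = j}"
  show "tor_cycles F i j \<subseteq> free.span ((\<lambda>b. single b 1) ` ?A)"
    using tor_cycles_subset free_module_span unfolding tensor_component_def by blast
  show "finite ((\<lambda>b. single b 1) ` ?A)"
    using F by (simp add: graded_free_resolution_def)
qed (fact tor_boundaries_subset_cycles[OF F] subspace_tor_boundaries)+

text \<open>This removes the choice in \<open>graded_betti\<close>: vanishing can be tested in any
  resolution, in particular in a Frobenius twist.\<close>

lemma graded_betti_eq_0_iff:
  assumes I: "graded_ideal I" and F: "graded_free_resolution I F"
  shows "graded_betti I i j = 0 \<longleftrightarrow> tor_cycles F i j \<subseteq> tor_boundaries F i j"
proof -
  have G: "graded_free_resolution I (SOME F. graded_free_resolution I F)"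
    using F by (rule someI)
  show ?thesis
    unfolding graded_betti_def tor_dim_eq_0_iff[OF G]
    using tor_vanishing_independent[OF I F G] tor_vanishing_independent[OF I G F] by blast
qed

section \<open>Splitting the Frobenius endomorphism\<close>

declare zero_power [simp]

text \<open>These are the linear maps to the ring from the ring on which scalars act through their
  \<open>q\<close>-th powers. For \<open>q = p ^ e\<close> in characteristic \<open>p\<close> they
  are known as \<open>p ^ (- e)\<close>-linear, or Cartier, maps.\<close>

definition semilin :: "nat \<Rightarrow> ('a::comm_ring_1 \<Rightarrow> 'a) \<Rightarrow> bool" where
  "semilin q c \<longleftrightarrow> additive c \<and> (\<forall>a f. c (a * f ^ q) = c a * f)"

text \<open>
  A finitary form of the statement that the \<open>q\<close>-th power map makes the ring a free module over
  itself: the \<open>u s\<close> are those basis elements which occur in the elements of \<open>A\<close>, and the \<open>c s\<close> are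
  the coordinate functions.
\<close>

definition frobenius_free :: "nat \<Rightarrow> 'a::comm_ring_1 itself \<Rightarrow> bool" where
  "frobenius_free q T \<longleftrightarrow> additive (\<lambda>x::'a. x ^ q) \<and> (\<forall>A::'a set. finite A \<longrightarrow>
     (\<exists>(n::nat) u c. (\<forall>s<n. semilin q (c s)) \<and> (\<forall>a\<in>A. (\<Sum>s<n. u s * c s a ^ q) = a)))"

text \<open>The definition uses natural indices, since a formula cannot quantify over types. The
  index sets that arise consist of field elements or of pairs, and are enumerated here.\<close>

lemma frobenius_freeI:
  assumes "additive (\<lambda>x::'a::comm_ring_1. x ^ q)"
    and "\<And>A::'a set. finite A \<Longrightarrow> \<exists>(S::'i set) u c. finite S \<and> (\<forall>s\<in>S. semilin q (c s)) \<and>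
      (\<forall>a\<in>A. (\<Sum>s\<in>S. u s * c s a ^ q) = a)"
  shows "frobenius_free q TYPE('a)"
  unfolding frobenius_free_def
proof (intro conjI allI impI)
  fix A :: "'a set" assume "finite A"
  then obtain S :: "'i set" and u c where S: "finite S" "\<And>s. s \<in> S \<Longrightarrow> semilin q (c s)"
      "\<And>a. a \<in> A \<Longrightarrow> (\<Sum>s\<in>S. u s * c s a ^ q) = a"
    using assms(2)[of A] by blast
  obtain h where h: "bij_betw h {0..<card S} S"
    using ex_bij_betw_nat_finite[OF S(1)] by blast
  have "(\<Sum>s<card S. u (h s) * c (h s) a ^ q) = a" if "a \<in> A" for a
    using sum.reindex_bij_betw[OF h, of "\<lambda>s. u s * c s a ^ q"] S(3)[OF that]
    by (simp add: atLeast0LessThan)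
  moreover have "semilin q (c (h s))" if "s < card S" for s
    using bij_betwE[OF h] that S(2) by simp
  ultimately show "\<exists>(n::nat) u c. (\<forall>s<n. semilin q (c s)) \<and> (\<forall>a\<in>A. (\<Sum>s<n. u s * c s a ^ q) = a)"
    by (intro exI[of _ "card S"] exI[of _ "u \<circ> h"] exI[of _ "c \<circ> h"]) simp
qed (fact assms(1))

lemma frobenius_freeE:
  assumes "frobenius_free q TYPE('a::comm_ring_1)" "finite (A :: 'a set)"
  obtains n :: nat and u :: "nat \<Rightarrow> 'a::comm_ring_1" and c :: "nat \<Rightarrow> 'a \<Rightarrow> 'a" where "\<forall>s<n. semilin q (c s)"
    "\<forall>a\<in>A. (\<Sum>s<n. u s * c s a ^ q) = a"
proof -
  have "\<exists>(n::nat) u c. (\<forall>s<n. semilin q (c s)) \<and> (\<forall>a\<in>A. (\<Sum>s<n. u s * c s a ^ q) = a)"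
    using assms by (simp add: frobenius_free_def)
  then show thesis
    by (elim exE conjE) (rule that)
qed

lemma frobenius_free_field:
  assumes add: "additive (\<lambda>x::'k::field. x ^ q)"
  shows "frobenius_free q TYPE('k)"
proof (rule frobenius_freeI[OF add])
  fix A :: "'k set" assume "finite A"
  \<comment> \<open>This is the field as a vector space over its subfield of \<open>q\<close>-th
    powers. Since a scalar acts through its \<open>q\<close>-th power, the coefficients in
    \<open>V.representation\<close> are already the \<open>q\<close>-th roots that the coordinate
    functions must return.\<close>
  interpret V: vector_space "\<lambda>c x :: 'k. c ^ q * x"
    by unfold_locales (simp_all add: distrib_left additive.add[OF add] distrib_right power_mult_distrib)
  obtain B where B: "V.independent B" "V.span B = UNIV"
    using V.independent_extend_basis[OF V.independent_empty] V.span_extend_basis[OF V.independent_empty]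
    by blast
  define c where "c s a = V.representation B a s" for s a
  \<comment> \<open>The basis may be infinite, but only finitely many of its elements occur in the
    finite set \<open>A\<close>.\<close>
  define S where "S = (\<Union>a\<in>A. {b. V.representation B a b \<noteq> 0})"
  have "finite S"
    using \<open>finite A\<close> by (simp add: S_def V.finite_representation)
  moreover have "semilin q (c s)" for s
    unfolding semilin_def
  proof (intro conjI allI)
    show "additive (c s)"
      by (rule additiveI) (simp add: c_def V.representation_add[OF B(1)] B(2))
    show "c s (a * f ^ q) = c s a * f" for a f
      using V.representation_scale[OF B(1), of a f] B(2) by (simp add: c_def mult.commute)
  qed
  moreover have "(\<Sum>s\<in>S. s * c s a ^ q) = a" if a: "a \<in> A" for a
  proof -
    have "(\<Sum>s\<in>S. s * c s a ^ q) = (\<Sum>s | V.representation B a s \<noteq> 0. V.representation B a s ^ q * s)"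
      using \<open>finite S\<close> a additive.zero[OF add]
      by (intro sum.mono_neutral_cong_right) (auto simp: S_def c_def mult.commute)
    also have "\<dots> = a"
      by (rule V.sum_nonzero_representation_eq[OF B(1)]) (simp add: B(2))
    finally show ?thesis .
  qed
  ultimately show "\<exists>(S::'k set) u c. finite S \<and> (\<forall>s\<in>S. semilin q (c s)) \<and>
      (\<forall>a\<in>A. (\<Sum>s\<in>S. u s * c s a ^ q) = a)"
    by (intro exI[of _ S] exI[of _ "\<lambda>s. s"] exI[of _ c]) simp
qed

section \<open>Coordinates of polynomials: division of exponents by \<open>q\<close>\<close>

abbreviation exp_times :: "nat \<Rightarrow> ('n \<Rightarrow>\<^sub>0 nat) \<Rightarrow> ('n \<Rightarrow>\<^sub>0 nat)" where
  "exp_times q \<equiv> Poly_Mapping.map (\<lambda>k. q * k)"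

abbreviation exp_div :: "nat \<Rightarrow> ('n \<Rightarrow>\<^sub>0 nat) \<Rightarrow> ('n \<Rightarrow>\<^sub>0 nat)" where
  "exp_div q \<equiv> Poly_Mapping.map (\<lambda>k. k div q)"

abbreviation exp_mod :: "nat \<Rightarrow> ('n \<Rightarrow>\<^sub>0 nat) \<Rightarrow> ('n \<Rightarrow>\<^sub>0 nat)" where
  "exp_mod q \<equiv> Poly_Mapping.map (\<lambda>k. k mod q)"

lemma single_power:
  fixes v :: "'k::comm_ring_1"
  shows "single s v ^ q = single (exp_times q s) (v ^ q)"
proof (induction q)
  case 0
  have "exp_times 0 s = 0"
    by (rule poly_mapping_eqI) (simp add: lookup_map)
  then show ?case by simp
next
  case (Suc q)
  have "exp_times (Suc q) s = s + exp_times q s"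
    by (rule poly_mapping_eqI) (simp add: lookup_map lookup_add)
  then show ?case
    by (simp add: Suc mult_single)
qed

lemma exp_mod_add_times: "exp_mod q (r + exp_times q s) = exp_mod q r"
  by (rule poly_mapping_eqI) (simp add: lookup_map lookup_add)

lemma exp_div_add_times: "0 < q \<Longrightarrow> exp_div q (r + exp_times q s) = exp_div q r + s"
  by (rule poly_mapping_eqI) (simp add: lookup_map lookup_add)

lemma exp_mod_div: "exp_mod q r + exp_times q (exp_div q r) = r"
  by (rule poly_mapping_eqI) (simp add: lookup_map lookup_add)

lemma additive_eqI:
  assumes "additive h" "additive h'" "\<And>t c. h (single t c) = h' (single t c)"
  shows "h f = h' f"
proof -
  have "h (\<Sum>t\<in>keys f. single t (lookup f t)) = h' (\<Sum>t\<in>keys f. single t (lookup f t))"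
    by (simp add: additive.sum[OF assms(1)] additive.sum[OF assms(2)] assms(3))
  then show ?thesis
    by (simp add: sum_single_lookup)
qed

text \<open>The coordinate at the product of the monomial with exponent \<open>a\<close> and the
  coefficient basis element belonging to \<open>c\<close>. A monomial with exponent \<open>r\<close>
  is a \<open>q\<close>-th power times the monomial with exponent \<open>exp_mod q r\<close>, so
  only those with residue \<open>a\<close> count.\<close>

definition exp_coord :: "nat \<Rightarrow> ('k \<Rightarrow> 'k) \<Rightarrow> ('n \<Rightarrow>\<^sub>0 nat) \<Rightarrow> ('n, 'k::comm_ring_1) mpoly \<Rightarrow> ('n, 'k) mpoly" where
  "exp_coord q c a f =
     (\<Sum>r\<in>keys f. if exp_mod q r = a then single (exp_div q r) (c (lookup f r)) else 0)"

lemma exp_coord_single: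
  assumes "additive c"
  shows "exp_coord q c a (single r w) = (if exp_mod q r = a then single (exp_div q r) (c w) else 0)"
  using additive.zero[OF assms] by (simp add: exp_coord_def)

lemma semilin_exp_coord:
  assumes add: "additive (\<lambda>f::('n, 'k::comm_ring_1) mpoly. f ^ q)" and "0 < q" and c: "semilin q c"
  shows "semilin q (exp_coord q c a :: ('n, 'k) mpoly \<Rightarrow> ('n, 'k) mpoly)"
proof -
  have addc: "additive c"
    using c by (simp add: semilin_def)
  have addh: "additive (exp_coord q c a :: ('n, 'k) mpoly \<Rightarrow> ('n, 'k) mpoly)"
  proof (rule additiveI)
    fix f g :: "('n, 'k) mpoly"
    show "exp_coord q c a (f + g) = exp_coord q c a f + exp_coord q c a g"
      unfolding exp_coord_def
      by (rule setsum_keys_plus_distrib[where f = "\<lambda>r w. if exp_mod q r = a then single (exp_div q r) (c w) else 0"])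
        (simp_all add: additive.zero[OF addc] additive.add[OF addc] single_add)
  qed
  \<comment> \<open>Both sides are additive in each factor, the left one because the
    \<open>q\<close>-th power is additive. This reduces the law to two monomials, where it is
    division with remainder.\<close>
  have "exp_coord q c a (single r w * f ^ q) = exp_coord q c a (single r w) * f" for r w and f :: "('n, 'k) mpoly"
  proof (rule additive_eqI[where f = f])
    show "additive (\<lambda>f. exp_coord q c a (single r w * f ^ q))"
      by (rule additiveI) (simp add: additive.add[OF add] additive.add[OF addh] distrib_left)
    show "additive (\<lambda>f. exp_coord q c a (single r w) * f)"
      by (rule additiveI) (simp add: distrib_left)
    show "exp_coord q c a (single r w * single s v ^ q) = exp_coord q c a (single r w) * single s v" for s v
      using c \<open>0 < q\<close> by (simp add: single_power mult_single exp_coord_single[OF addc]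
          exp_mod_add_times exp_div_add_times semilin_def)
  qed
  then have "exp_coord q c a (g * f ^ q) = exp_coord q c a g * f" for f g :: "('n, 'k) mpoly"
    by (rule additive_eqI[rotated 2]; intro additiveI) (simp_all add: distrib_right additive.add[OF addh])
  with addh show ?thesis
    by (simp add: semilin_def)
qed

lemma frobenius_free_mpoly:
  assumes add: "additive (\<lambda>f::('n, 'k::comm_ring_1) mpoly. f ^ q)" and "0 < q"
    and free: "frobenius_free q TYPE('k)"
  shows "frobenius_free q TYPE(('n, 'k) mpoly)"
proof (rule frobenius_freeI[OF add])
  fix A :: "('n, 'k) mpoly set" assume "finite A"
  \<comment> \<open>The finitary freeness of the coefficient ring is applied to all coefficients
    that occur in \<open>A\<close>, and \<open>T\<close> collects all exponent residues that
    occur.\<close>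
  define W where "W = (\<Union>f\<in>A. lookup f ` keys f)"
  define T where "T = (\<Union>f\<in>A. exp_mod q ` keys f)"
  have fin: "finite W" "finite T"
    using \<open>finite A\<close> by (auto simp: W_def T_def)
  obtain n :: nat and u :: "nat \<Rightarrow> 'k" and c where "\<forall>s<n. semilin q (c s)"
      "\<forall>w\<in>W. (\<Sum>s<n. u s * c s w ^ q) = w"
    by (rule frobenius_freeE[OF free fin(1)])
  note c = this[rule_format]
  have "(\<Sum>(s, a)\<in>{..<n} \<times> T. single a (u s) * exp_coord q (c s) a f ^ q) = f" if f: "f \<in> A" for f
  proof -
    have "(\<Sum>(s, a)\<in>{..<n} \<times> T. single a (u s) * exp_coord q (c s) a f ^ q) =
      (\<Sum>(s, a)\<in>{..<n} \<times> T. \<Sum>r\<in>keys f. if exp_mod q r = a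
        then single (a + exp_times q (exp_div q r)) (u s * c s (lookup f r) ^ q) else 0)"
      using additive.zero[OF add]
      by (simp add: exp_coord_def additive.sum[OF add] sum_distrib_left
          single_power mult_single if_distrib[of "\<lambda>x. x ^ q"] if_distrib[of "\<lambda>x. _ * x"] cong: if_cong)
    also have "\<dots> = (\<Sum>s<n. \<Sum>a\<in>T. \<Sum>r\<in>keys f. if exp_mod q r = a
        then single (a + exp_times q (exp_div q r)) (u s * c s (lookup f r) ^ q) else 0)"
      by (rule sum.cartesian_product[symmetric])
    also have "\<dots> = (\<Sum>s<n. \<Sum>r\<in>keys f. \<Sum>a\<in>T. if exp_mod q r = a
        then single (a + exp_times q (exp_div q r)) (u s * c s (lookup f r) ^ q) else 0)"
      by (intro sum.cong refl sum.swap)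
    \<comment> \<open>For each \<open>r\<close> exactly one \<open>a\<close> contributes, the
      residue of \<open>r\<close>, and remainder plus \<open>q\<close> times quotient restores
      \<open>r\<close>.\<close>
    also have "\<dots> = (\<Sum>s<n. \<Sum>r\<in>keys f. single r (u s * c s (lookup f r) ^ q))"
      using fin(2) f by (intro sum.cong refl) (auto simp: sum.delta' exp_mod_div T_def)
    also have "\<dots> = (\<Sum>r\<in>keys f. single r (\<Sum>s<n. u s * c s (lookup f r) ^ q))"
      by (subst sum.swap) (simp add: single_sum)
    also have "\<dots> = (\<Sum>r\<in>keys f. single r (lookup f r))"
      using f by (intro sum.cong refl arg_cong[of _ _ "single _"] c(2)) (auto simp: W_def)
    also have "\<dots> = f"
      by (rule sum_single_lookup)
    finally show ?thesis .
  qed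
  then show "\<exists>(S::(nat \<times> ('n \<Rightarrow>\<^sub>0 nat)) set) u c. finite S \<and> (\<forall>s\<in>S. semilin q (c s)) \<and>
      (\<forall>a\<in>A. (\<Sum>s\<in>S. u s * c s a ^ q) = a)"
    using fin(2) semilin_exp_coord[OF add \<open>0 < q\<close>] c(1)
    by (intro exI[of _ "{..<n} \<times> T"] exI[of _ "\<lambda>(s, a). single a (u s)"]
        exI[of _ "\<lambda>(s, a). exp_coord q (c s) a"]) (auto simp: split_def)
qed

section \<open>Vectors and matrices of \<open>q\<close>-th powers\<close>

abbreviation frv :: "nat \<Rightarrow> (nat \<Rightarrow>\<^sub>0 'a::comm_ring_1) \<Rightarrow> (nat \<Rightarrow>\<^sub>0 'a)" where
  "frv q \<equiv> Poly_Mapping.map (\<lambda>f. f ^ q)"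

lemma frv_lin_ext:
  assumes "additive (\<lambda>f::'a::comm_ring_1. f ^ q)"
  shows "frv q (lin_ext g x) = lin_ext (\<lambda>b. frv q (g b)) (frv q (x :: nat \<Rightarrow>\<^sub>0 'a))"
  by (rule map_lin_ext_hom[OF assms power_mult_distrib])

lemma semilin_lin_ext:
  assumes "semilin q c" "0 < q"
  shows "Poly_Mapping.map c (lin_ext (\<lambda>b. frv q (g b)) x) = lin_ext g (Poly_Mapping.map c x)"
proof -
  have "Poly_Mapping.map (\<lambda>c. c) y = y" for y :: "nat \<Rightarrow>\<^sub>0 'a"
    by (rule poly_mapping_eqI) (simp add: lookup_map)
  then show ?thesis
    using map_lin_ext[of c "\<lambda>f. f ^ q" "\<lambda>c. c" g x, OF _ zero_power[OF assms(2)] refl] assms(1)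
    by (simp add: semilin_def)
qed

text \<open>The form in which flatness is used, twice for exactness of the twisted resolution and
  once for Tor. Membership in the image of the twisted matrix is tested on coordinates, because
  preimages of the coordinates recombine linearly after being raised to the \<open>q\<close>-th
  power.\<close>

lemma frobenius_image:
  fixes x :: "nat \<Rightarrow>\<^sub>0 'a::comm_ring_1"
  assumes free: "frobenius_free q TYPE('a)"
    and im: "\<And>c. semilin q c \<Longrightarrow> Poly_Mapping.map c x \<in> lin_ext g ` free_module B"
  shows "x \<in> lin_ext (\<lambda>b. frv q (g b)) ` free_module B"
proof -
  have add: "additive (\<lambda>f::'a. f ^ q)"
    using free by (simp add: frobenius_free_def)
  \<comment> \<open>For \<open>q = 0\<close> the power map would be constantly \<open>1\<close>,
    which is not additive.\<close>
  then have "0 < q"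
    using additive.zero[OF add] by (cases q) auto
  obtain n :: nat and u c where "\<forall>s<n. semilin q (c s)"
      "\<forall>a\<in>lookup x ` keys x. (\<Sum>s<n. u s * c s a ^ q) = a"
    by (rule frobenius_freeE[OF free finite_imageI[OF finite_keys]])
  note c = this[rule_format]
  obtain z where z: "\<And>s. s < n \<Longrightarrow> z s \<in> free_module B"
      "\<And>s. s < n \<Longrightarrow> Poly_Mapping.map (c s) x = lin_ext g (z s)"
    using im[OF c(1)] unfolding image_iff Bex_def by metis
  have c0: "c s 0 = 0" if "s < n" for s
    using additive.zero c(1)[OF that] by (auto simp: semilin_def)
  have "x = (\<Sum>s<n. smult (u s) (frv q (Poly_Mapping.map (c s) x)))"
  proof (rule poly_mapping_eqI)
    fix b
    have "(\<Sum>s<n. u s * c s (lookup x b) ^ q) = lookup x b"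
    proof (cases "lookup x b = 0")
      case True
      then show ?thesis using c0 \<open>0 < q\<close> by simp
    next
      case False
      then show ?thesis by (intro c(2)) (simp add: in_keys_iff)
    qed
    then show "lookup x b = lookup (\<Sum>s<n. smult (u s) (frv q (Poly_Mapping.map (c s) x))) b"
      using c0 \<open>0 < q\<close> by (simp add: lookup_sum lookup_map)
  qed
  also have "\<dots> = lin_ext (\<lambda>b. frv q (g b)) (\<Sum>s<n. smult (u s) (frv q (z s)))"
    by (simp add: z(2) frv_lin_ext[OF add] lin_ext_sum lin_ext_smult)
  finally show ?thesis
    using z(1) by (blast intro: free_module_sum free_module_smult free_module_map)
qed

section \<open>The Frobenius functor\<close>

definition frobenius_complex :: "nat \<Rightarrow> ('n::finite, 'k::field) free_complex \<Rightarrow> ('n, 'k) free_complex" where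
  "frobenius_complex q F = \<lparr>gens = gens F, gdeg = \<lambda>i b. q * gdeg F i b, aug = \<lambda>b. aug F b ^ q,
     bdry = \<lambda>i b. frv q (bdry F i b)\<rparr>"

lemma frobenius_power_base: "f \<in> I \<Longrightarrow> f ^ q \<in> frobenius_power q I"
  unfolding frobenius_power_def ideal_span_def by (intro module.span_base[OF module_times] imageI)

lemma subspace_frobenius_power: "module.subspace (*) (frobenius_power q I)"
  unfolding frobenius_power_def by (rule subspace_ideal_span)

text \<open>By additivity \<open>f ^ q\<close> is the sum of the \<open>q\<close>-th powers of the
  components of \<open>f\<close>, and these components lie in \<open>I\<close>. So
  \<open>q\<close>-th powers of homogeneous elements generate.\<close>

lemma graded_ideal_frobenius_power:
  fixes I :: "('n::finite, 'k::field) mpoly set"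
  assumes add: "additive (\<lambda>f::('n, 'k) mpoly. f ^ q)" and I: "graded_ideal I"
  shows "graded_ideal (frobenius_power q I)"
proof (rule homogeneous_ideal_imp_graded_ideal)
  define S where "S = (\<lambda>f. f ^ q) ` {f \<in> I. \<exists>d. homogeneous d f}"
  have "f ^ q \<in> ideal_span S" if "f \<in> I" for f
  proof -
    obtain N where "(\<Sum>d<N. hpart d f) = f"
      using sum_hpart by blast
    then have "f ^ q = (\<Sum>d<N. hpart d f ^ q)"
      using additive.sum[OF add, of "\<lambda>d. hpart d f" "{..<N}"] by simp
    also have "\<dots> \<in> ideal_span S"
    proof (rule ideal_sum[OF subspace_ideal_span])
      fix d
      have "hpart d f ^ q \<in> S"
        using I that homogeneous_hpart unfolding S_def graded_ideal_def by blast
      then show "hpart d f ^ q \<in> ideal_span S"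
        unfolding ideal_span_def by (rule module.span_base[OF module_times])
    qed
    finally show ?thesis .
  qed
  then have "frobenius_power q I \<subseteq> ideal_span S"
    unfolding frobenius_power_def ideal_span_def[of "_ ` _"]
    by (intro module.span_minimal[OF module_times] subspace_ideal_span) auto
  moreover have "ideal_span S \<subseteq> frobenius_power q I"
    unfolding frobenius_power_def ideal_span_def S_def
    by (intro module.span_mono[OF module_times] image_mono) auto
  ultimately show "homogeneous_ideal (frobenius_power q I)"
    unfolding homogeneous_ideal_def S_def by (intro exI[of _ S]) (auto simp: S_def intro: homogeneous_power)
qed

text \<open>Applied to a generator, \<open>c (r * f ^ q) = c r * f\<close> is a multiple of
  \<open>f\<close>. This handles exactness at index \<open>0\<close>, where cycles are defined by
  membership in an ideal.\<close>

lemma semilin_frobenius_power: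
  assumes I: "module.subspace (*) I" and c: "semilin q c" and f: "f \<in> frobenius_power q I"
  shows "c f \<in> I"
proof -
  from f obtain t r where t: "finite t" "t \<subseteq> (\<lambda>f. f ^ q) ` I" and f: "f = (\<Sum>a\<in>t. r a * a)"
    unfolding frobenius_power_def ideal_span_def module.span_explicit[OF module_times] by blast
  have "c (r a * a) \<in> I" if "a \<in> t" for a
    using t that c by (auto simp: semilin_def ideal_mult[OF I])
  moreover have "additive c"
    using c by (simp add: semilin_def)
  ultimately show ?thesis
    unfolding f by (simp add: additive.sum ideal_sum[OF I])
qed

text \<open>Homogeneity is stated coefficientwise, so that \<open>homogeneous_power\<close> can be
  applied to each entry of a vector.\<close>

lemma homogeneous_vec_alt:
  "homogeneous_vec dg d x \<longleftrightarrow>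
     (\<forall>b. lookup x b \<noteq> 0 \<longrightarrow> dg b \<le> d \<and> homogeneous (d - dg b) (lookup x b))"
proof
  assume x: "homogeneous_vec dg d x"
  show "\<forall>b. lookup x b \<noteq> 0 \<longrightarrow> dg b \<le> d \<and> homogeneous (d - dg b) (lookup x b)"
  proof (intro allI impI)
    fix b assume "lookup x b \<noteq> 0"
    then obtain t where "lookup (lookup x b) t \<noteq> 0"
      by (metis lookup_zero poly_mapping_eqI)
    then show "dg b \<le> d \<and> homogeneous (d - dg b) (lookup x b)"
      using x by (fastforce simp: homogeneous_vec_iff homogeneous_iff)
  qed
next
  assume x: "\<forall>b. lookup x b \<noteq> 0 \<longrightarrow> dg b \<le> d \<and> homogeneous (d - dg b) (lookup x b)"
  show "homogeneous_vec dg d x"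
    unfolding homogeneous_vec_def
  proof (intro ballI)
    fix b t assume "b \<in> keys x" "t \<in> keys (lookup x b)"
    then show "mon_deg t + dg b = d"
      using x by (auto simp: homogeneous_def in_keys_iff)
  qed
qed

lemma homogeneous_vec_frv:
  assumes "0 < q" "homogeneous_vec dg d x"
  shows "homogeneous_vec (\<lambda>b. q * dg b) (q * d) (frv q x)"
  unfolding homogeneous_vec_alt
proof (intro allI impI)
  fix b assume "lookup (frv q x) b \<noteq> 0"
  then have "lookup x b \<noteq> 0"
    using assms(1) by (auto simp: lookup_map)
  then have "dg b \<le> d" "homogeneous (d - dg b) (lookup x b)"
    using assms(2) by (auto simp: homogeneous_vec_alt)
  then show "q * dg b \<le> q * d \<and> homogeneous (q * d - q * dg b) (lookup (frv q x) b)"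
    using homogeneous_power[of "d - dg b" "lookup x b" q] assms(1)
    by (simp add: lookup_map right_diff_distrib')
qed

text \<open>Every semilinear map intertwines the differentials of the twisted complex and of
  \<open>F\<close>, so it takes cycles to cycles. Exactness of \<open>F\<close> then gives the
  hypothesis of \<open>frobenius_image\<close>. The opposite inclusions are linear and are checked
  on basis elements.\<close>

lemma frobenius_complex_resolution:
  fixes I :: "('n::finite, 'k::field) mpoly set"
  assumes free: "frobenius_free q TYPE(('n, 'k) mpoly)" and I: "module.subspace (*) I"
    and F: "graded_free_resolution I F"
  shows "graded_free_resolution (frobenius_power q I) (frobenius_complex q F)" (is "graded_free_resolution ?I ?F")
proof -
  note I' = subspace_frobenius_power[of q I]
  have add: "additive (\<lambda>f::('n, 'k) mpoly. f ^ q)"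
    using free by (simp add: frobenius_free_def)
  have q: "0 < q"
    using additive.zero[OF add] by (cases q) auto
  have [simp]: "gens ?F = gens F"
    by (simp add: frobenius_complex_def)
  have diff: "differential ?F i = lin_ext (\<lambda>b. frv q (bdry F i b))" for i
    by (simp add: frobenius_complex_def differential_def)
  have aug: "augmentation ?F x = lookup (lin_ext (\<lambda>b. frv q (single 0 (aug F b))) x) 0" for x
    using q by (simp add: frobenius_complex_def augmentation_eq)
  have aug_frv: "augmentation ?F (frv q x) = augmentation F x ^ q" for x
    unfolding aug frv_lin_ext[OF add, symmetric] using q by (simp add: lookup_map augmentation_eq)
  have diff_frv: "differential ?F i (frv q x) = frv q (differential F i x)" for i x
    unfolding diff frv_lin_ext[OF add, symmetric] by (simp add: differential_def)
  have aug_semilin: "augmentation F (Poly_Mapping.map c x) = c (augmentation ?F x)" if c: "semilin q c" for c x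
  proof -
    have "c 0 = 0"
      using c additive.zero by (auto simp: semilin_def)
    then show ?thesis
      unfolding aug augmentation_eq[of F] semilin_lin_ext[OF c q, symmetric] by (simp add: lookup_map)
  qed
  have diff_semilin: "differential F i (Poly_Mapping.map c x) = Poly_Mapping.map c (differential ?F i x)"
    if c: "semilin q c" for c i x
    unfolding diff semilin_lin_ext[OF c q] by (simp add: differential_def)
  have hom: "hom_on ?F (Suc i) ?F i (bdry ?F i)" for i
    using resolution_hom[OF F, of i] q
    by (simp add: frobenius_complex_def gr_hom_def free_module_map homogeneous_vec_frv)
  have bdry_cycle: "bdry F i b \<in> res_cycles I F i" if "b \<in> gens F (Suc i)" for i b
    using differential_in_res_cycles[OF F free_module_single[OF that, of 1]]
    by (simp add: differential_def)
  have diff_free: "differential ?F i y \<in> free_module (gens F i)" if "y \<in> free_module (gens F (Suc i))" for i y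
    using gr_hom_free_module[OF hom, of y i] that by (simp add: differential_def)
  show ?thesis
    unfolding graded_free_resolution_def
  proof (intro conjI allI ballI)
    show "finite {b \<in> gens ?F i. gdeg ?F i b = j}" for i j
    proof (rule finite_subset)
      show "{b \<in> gens ?F i. gdeg ?F i b = j} \<subseteq> {b \<in> gens F i. gdeg F i b = j div q}"
        using q by (auto simp: frobenius_complex_def)
      show "finite {b \<in> gens F i. gdeg F i b = j div q}"
        using F by (simp add: graded_free_resolution_def)
    qed
    show "homogeneous (gdeg ?F 0 b) (aug ?F b)" if "b \<in> gens ?F 0" for b
      using F that by (simp add: frobenius_complex_def graded_free_resolution_def homogeneous_power)
    show "bdry ?F i b \<in> free_module (gens ?F i)"
      "homogeneous_vec (gdeg ?F i) (gdeg ?F (Suc i) b) (bdry ?F i b)" if "b \<in> gens ?F (Suc i)" for i b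
      using hom[of i] that by (auto simp: gr_hom_def)
    show "\<exists>x\<in>free_module (gens ?F 0). r - augmentation ?F x \<in> ?I" for r
    proof -
      have "\<forall>r. \<exists>x\<in>free_module (gens F 0). r - augmentation F x \<in> I"
        using F by (simp add: graded_free_resolution_def)
      then obtain x where x: "x \<in> free_module (gens F 0)" "1 - augmentation F x \<in> I"
        by blast
      \<comment> \<open>Since \<open>r\<close> need not be a \<open>q\<close>-th power, a preimage
        is twisted only for \<open>1\<close>, which is its own \<open>q\<close>-th power, and then
        multiplied by \<open>r\<close>.\<close>
      have "r - augmentation ?F (smult r (frv q x)) = r * (1 ^ q - augmentation F x ^ q)"
        unfolding aug_frv[symmetric] by (simp add: aug lin_ext_smult algebra_simps)
      also have "\<dots> = r * (1 - augmentation F x) ^ q"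
        by (simp only: additive.diff[OF add])
      also have "\<dots> \<in> ?I"
        by (intro ideal_mult[OF I'] frobenius_power_base x(2))
      finally show ?thesis
        using x(1) by (intro bexI[of _ "smult r (frv q x)"]) (simp_all add: free_module_smult free_module_map)
    qed
    show "{x \<in> free_module (gens ?F 0). augmentation ?F x \<in> ?I} =
        differential ?F 0 ` free_module (gens ?F (Suc 0))" (is "?L = ?R")
    proof
      show "?L \<subseteq> ?R"
      proof
        fix x assume x: "x \<in> ?L"
        have "Poly_Mapping.map c x \<in> lin_ext (bdry F 0) ` free_module (gens F (Suc 0))" if c: "semilin q c" for c
        proof -
          have "Poly_Mapping.map c x \<in> res_cycles I F 0"
            using x semilin_frobenius_power[OF I c] by (simp add: aug_semilin[OF c] free_module_map)
          then show ?thesis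
            unfolding resolution_exact[OF F] by (simp add: differential_def)
        qed
        from frobenius_image[OF free this] show "x \<in> ?R"
          by (simp add: diff)
      qed
      show "?R \<subseteq> ?L"
      proof safe
        fix y :: "nat \<Rightarrow>\<^sub>0 ('n, 'k) mpoly" assume y: "y \<in> free_module (gens ?F (Suc 0))"
        then show "differential ?F 0 y \<in> free_module (gens ?F 0)"
          using diff_free by simp
        \<comment> \<open>The vector \<open>y\<close> need not consist of \<open>q\<close>-th
          powers, but the images of basis elements do, and for these the augmentation is the
          \<open>q\<close>-th power of an element of \<open>I\<close>.\<close>
        have "augmentation ?F (differential ?F 0 y) =
            (\<Sum>b\<in>keys y. lookup y b * augmentation ?F (frv q (bdry F 0 b)))"
          by (simp add: diff aug lin_ext_lin_ext lookup_lin_ext[of _ y])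
        also have "\<dots> \<in> ?I"
        proof (intro ideal_sum[OF I'] ideal_mult[OF I'])
          fix b assume "b \<in> keys y"
          then have "b \<in> gens F (Suc 0)"
            using y by (auto simp: free_module_def)
          from bdry_cycle[OF this] show "augmentation ?F (frv q (bdry F 0 b)) \<in> ?I"
            by (simp add: aug_frv frobenius_power_base)
        qed
        finally show "augmentation ?F (differential ?F 0 y) \<in> ?I" .
      qed
    qed
    show "{x \<in> free_module (gens ?F (Suc i)). differential ?F i x = 0} =
        differential ?F (Suc i) ` free_module (gens ?F (Suc (Suc i)))" (is "?L = ?R") for i
    proof
      show "?L \<subseteq> ?R"
      proof
        fix x assume x: "x \<in> ?L"
        have "Poly_Mapping.map c x \<in> lin_ext (bdry F (Suc i)) ` free_module (gens F (Suc (Suc i)))"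
          if c: "semilin q c" for c
        proof -
          have "c 0 = 0"
            using c additive.zero by (auto simp: semilin_def)
          then have "Poly_Mapping.map c x \<in> res_cycles I F (Suc i)"
            using x by (simp add: diff_semilin[OF c] free_module_map Poly_Mapping.map_eq_zero_iff)
          then show ?thesis
            unfolding resolution_exact[OF F] by (simp add: differential_def)
        qed
        from frobenius_image[OF free this] show "x \<in> ?R"
          by (simp add: diff)
      qed
      show "?R \<subseteq> ?L"
      proof safe
        fix y :: "nat \<Rightarrow>\<^sub>0 ('n, 'k) mpoly" assume y: "y \<in> free_module (gens ?F (Suc (Suc i)))"
        then show "differential ?F (Suc i) y \<in> free_module (gens ?F (Suc i))"
          using diff_free by simp
        have "differential ?F i (frv q (bdry F (Suc i) b)) = 0" if "b \<in> keys y" for b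
        proof -
          have "b \<in> gens F (Suc (Suc i))"
            using y that by (auto simp: free_module_def)
          from bdry_cycle[OF this] show ?thesis
            using q by (simp add: diff_frv Poly_Mapping.map_eq_zero_iff)
        qed
        moreover have "differential ?F i (differential ?F (Suc i) y) =
            lin_ext (\<lambda>b. differential ?F i (frv q (bdry F (Suc i) b))) y"
          by (simp add: diff lin_ext_lin_ext)
        ultimately show "differential ?F i (differential ?F (Suc i) y) = 0"
          by (simp add: lin_ext_def)
      qed
    qed
  qed
qed

section \<open>Tor of the twisted complex\<close>

lemma const_coeff_power: "const_coeff (f ^ q) = const_coeff (f :: ('n, 'k::comm_ring_1) mpoly) ^ q"
  by (induction q) (simp_all add: const_coeff_mult, simp add: const_coeff_def)

lemma bar_frv:
  assumes "0 < q"
  shows "bar (frv q x) = frv q (bar x)"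
  by (rule poly_mapping_eqI) (use assms in \<open>simp add: lookup_map const_coeff_power\<close>)

text \<open>The coordinates of \<open>1\<close> recombine to \<open>1\<close>, so one of them is
  nonzero. Dividing that coordinate function by its value at \<open>1\<close> splits the power
  map.\<close>

lemma frobenius_left_inverse:
  assumes "frobenius_free q TYPE('k::field)"
  obtains c :: "'k::field \<Rightarrow> 'k" where "semilin q c" "\<And>a. c (a ^ q) = a"
proof -
  have add: "additive (\<lambda>f::'k. f ^ q)"
    using assms by (simp add: frobenius_free_def)
  have q: "0 < q"
    using additive.zero[OF add] by (cases q) auto
  obtain n :: nat and u c where "\<forall>s<n. semilin q (c s)"
      "\<forall>a\<in>{1}. (\<Sum>s<n. u s * c s a ^ q) = (a::'k)"
    by (rule frobenius_freeE[OF assms finite.insertI[OF finite.emptyI]])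
  note c = this[rule_format]
  have "\<exists>s<n. c s 1 \<noteq> 0"
  proof (rule ccontr)
    assume "\<not> ?thesis"
    then have "(\<Sum>s<n. u s * c s (1::'k) ^ q) = 0"
      using q by (intro sum.neutral) auto
    with c(2) show False by simp
  qed
  then obtain s where s: "s < n" "c s 1 \<noteq> 0"
    by blast
  have lin: "additive (c s)" "c s (a * f ^ q) = c s a * f" for a f
    using c(1)[OF s(1)] by (auto simp: semilin_def)
  show thesis
  proof (rule that[of "\<lambda>a. c s a / c s 1"])
    show "semilin q (\<lambda>a. c s a / c s 1)"
      unfolding semilin_def
      by (auto intro!: additiveI simp: lin(2) additive.add[OF lin(1)] add_divide_distrib)
    show "c s (a ^ q) / c s 1 = a" for a
      using lin(2)[of 1 a] s(2) by simp
  qed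
qed

text \<open>The reduced twisted matrix consists of \<open>q\<close>-th powers of field elements.
  From right to left this is \<open>frobenius_image\<close> over the field; from left to right the
  splitting of the power map pulls preimages back.\<close>

lemma frobenius_tor_vanishing:
  fixes F :: "('n::finite, 'k::field) free_complex"
  assumes free: "frobenius_free q TYPE('k)"
  shows "tor_cycles (frobenius_complex q F) i (q * j) \<subseteq> tor_boundaries (frobenius_complex q F) i (q * j) \<longleftrightarrow>
    tor_cycles F i j \<subseteq> tor_boundaries F i j" (is "tor_cycles ?F _ _ \<subseteq> _ \<longleftrightarrow> _")
proof -
  have add: "additive (\<lambda>f::'k. f ^ q)"
    using free by (simp add: frobenius_free_def)
  have q: "0 < q"
    using additive.zero[OF add] by (cases q) auto
  have comp: "tensor_component ?F i (q * j) = tensor_component F i j" for i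
    using q by (simp add: tensor_component_def frobenius_complex_def)
  have diff: "tensor_differential ?F i = lin_ext (\<lambda>b. frv q (bar (bdry F i b)))" for i
    using q by (simp add: tensor_differential_def frobenius_complex_def bar_frv)
  have map: "Poly_Mapping.map f x \<in> tensor_component F i j" if "x \<in> tensor_component F i j" for f x i
    using that unfolding tensor_component_def by (rule free_module_map)
  have cyc: "x \<in> tor_cycles G i l \<longleftrightarrow> x \<in> tensor_component G i l \<and>
      (\<forall>k. i = Suc k \<longrightarrow> tensor_differential G k x = 0)" for G :: "('n, 'k) free_complex" and x l
    by (cases i) auto
  show ?thesis
  proof
    assume van: "tor_cycles ?F i (q * j) \<subseteq> tor_boundaries ?F i (q * j)"
    obtain c :: "'k \<Rightarrow> 'k" where c: "semilin q c" "\<And>a. c (a ^ q) = a"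
      using frobenius_left_inverse[OF free] by blast
    have c0: "c 0 = 0"
      using c(2)[of 0] q by simp
    show "tor_cycles F i j \<subseteq> tor_boundaries F i j"
    proof
      fix x assume x: "x \<in> tor_cycles F i j"
      have "frv q x \<in> tor_cycles ?F i (q * j)"
        unfolding cyc
      proof (intro conjI allI impI)
        show "frv q x \<in> tensor_component ?F i (q * j)"
          using x by (simp add: comp map cyc)
        show "tensor_differential ?F k (frv q x) = 0" if "i = Suc k" for k
          unfolding diff frv_lin_ext[OF add, symmetric] using x that q
          by (simp add: tensor_differential_def Poly_Mapping.map_eq_zero_iff)
      qed
      then obtain y where y: "y \<in> tensor_component F (Suc i) j" "frv q x = tensor_differential ?F i y"
        using van by (auto simp: tor_boundaries_def comp)
      \<comment> \<open>The preimage \<open>y\<close> of \<open>frv q x\<close> need not consist of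
        \<open>q\<close>-th powers. The splitting \<open>c\<close> recovers \<open>x\<close> and at
        the same time turns \<open>y\<close> into a preimage under the original matrix.\<close>
      have "Poly_Mapping.map c (frv q x) = x"
        by (rule poly_mapping_eqI) (use q c0 c(2) in \<open>simp add: lookup_map zero_power\<close>)
      then have "x = tensor_differential F i (Poly_Mapping.map c y)"
        unfolding y(2) diff semilin_lin_ext[OF c(1) q] by (simp add: tensor_differential_def)
      then show "x \<in> tor_boundaries F i j"
        using map[OF y(1)] by (auto simp: tor_boundaries_def)
    qed
  next
    assume van: "tor_cycles F i j \<subseteq> tor_boundaries F i j"
    show "tor_cycles ?F i (q * j) \<subseteq> tor_boundaries ?F i (q * j)"
    proof
      fix x assume x: "x \<in> tor_cycles ?F i (q * j)"
      have "Poly_Mapping.map c x \<in> lin_ext (\<lambda>b. bar (bdry F i b)) ` tensor_component F (Suc i) j"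
        if c: "semilin q c" for c
      proof -
        have c0: "c 0 = 0"
          using c additive.zero by (auto simp: semilin_def)
        have "Poly_Mapping.map c x \<in> tor_cycles F i j"
          unfolding cyc
        proof (intro conjI allI impI)
          show "Poly_Mapping.map c x \<in> tensor_component F i j"
            using x by (simp add: comp map cyc)
          show "tensor_differential F k (Poly_Mapping.map c x) = 0" if "i = Suc k" for k
            using x that c0
            by (simp add: diff semilin_lin_ext[OF c q, symmetric] tensor_differential_def[of F]
              Poly_Mapping.map_eq_zero_iff)
        qed
        then show ?thesis
          using van by (auto simp: tor_boundaries_def tensor_differential_def)
      qed
      from frobenius_image[OF free this[unfolded tensor_component_def]]
      show "x \<in> tor_boundaries ?F i (q * j)"
        unfolding tor_boundaries_def comp diff by (simp add: tensor_component_def)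
    qed
  qed
qed

section \<open>Characteristic \<open>p\<close> and the nonzero Betti numbers\<close>

lemma additive_power_char:
  fixes p :: nat
  assumes "CHAR('a::comm_ring_1) = p" "prime p"
  shows "additive (\<lambda>x::'a. x ^ (p ^ e))"
  by (rule additiveI) (use assms in \<open>simp add: freshmans_dream'[where n = e]\<close>)

lemma CHAR_mpoly: "CHAR(('n, 'k::comm_ring_1) mpoly) = CHAR('k)"
proof (rule CHAR_eqI)
  have iff: "of_nat n = (0::('n, 'k) mpoly) \<longleftrightarrow> of_nat n = (0::'k)" for n
  proof
    assume "of_nat n = (0::('n, 'k) mpoly)"
    then have "lookup (of_nat n :: ('n, 'k) mpoly) 0 = 0"
      by simp
    then show "of_nat n = (0::'k)"
      by (simp add: lookup_of_nat)
  next
    assume "of_nat n = (0::'k)"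
    then have "single 0 (of_nat n) = (0::('n, 'k) mpoly)"
      by (simp del: single_of_nat)
    then show "of_nat n = (0::('n, 'k) mpoly)"
      by simp
  qed
  show "of_nat CHAR('k) = (0::('n, 'k) mpoly)"
    unfolding iff by simp
  show "CHAR('k) dvd n" if "of_nat n = (0::('n, 'k) mpoly)" for n
    using that unfolding iff by (simp add: of_nat_eq_0_iff_char_dvd)
qed

lemma graded_betti_frobenius_power:
  fixes I :: "('n::finite, 'k::field) mpoly set"
  assumes "CHAR('k) = p" "p > 0" "homogeneous_ideal I" and q: "q = p ^ e"
  shows "graded_betti (frobenius_power q I) i j \<noteq> 0 \<longleftrightarrow> (\<exists>l. j = q * l \<and> graded_betti I i l \<noteq> 0)"
proof -
  have "prime p"
    using assms(1,2) prime_CHAR_semidom by blast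
  have add: "additive (\<lambda>x::'k. x ^ q)" "additive (\<lambda>x::('n, 'k) mpoly. x ^ q)"
    unfolding q using \<open>prime p\<close> assms(1) by (auto intro!: additive_power_char simp: CHAR_mpoly)
  have q0: "0 < q"
    using assms(2) q by simp
  have free: "frobenius_free q TYPE('k)"
    by (rule frobenius_free_field[OF add(1)])
  have I: "graded_ideal I"
    by (rule homogeneous_ideal_imp_graded_ideal) fact
  then obtain F where F: "graded_free_resolution I F"
    using graded_free_resolution_exists by blast
  let ?F = "frobenius_complex q F"
  have F': "graded_free_resolution (frobenius_power q I) ?F"
    using I by (intro frobenius_complex_resolution[OF _ _ F] frobenius_free_mpoly add q0 free)
      (simp add: graded_ideal_def)
  note betti = graded_betti_eq_0_iff[OF I F]
    graded_betti_eq_0_iff[OF graded_ideal_frobenius_power[OF add(2) I] F']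
  show ?thesis
  proof (cases "q dvd j")
    case True
    then obtain l where "j = q * l" ..
    then show ?thesis
      using q0 by (auto simp: betti frobenius_tor_vanishing[OF free])
  next
    case False
    \<comment> \<open>All generators of the twisted resolution sit in degrees divisible by
      \<open>q\<close>, so in the other degrees the complex itself is zero.\<close>
    then have no_gens: "{b \<in> gens F i. q * gdeg F i b = j} = {}"
      by auto
    have "tensor_component ?F i j = {0}"
      by (simp add: tensor_component_def frobenius_complex_def free_module_def no_gens)
    then have "tor_cycles ?F i j \<subseteq> tor_boundaries ?F i j"
      using tor_cycles_subset[of ?F i j] free.subspace_0[OF subspace_tor_boundaries[of ?F i j]] by auto
    with False show ?thesis
      by (auto simp: betti)
  qed
qed

theorem proposition2p12:
  fixes I :: "('n::finite, 'k::field) mpoly set" and p e :: nat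
  assumes "CHAR('k) = p" and "p > 0"
    and "homogeneous_ideal I"
    and "e \<ge> 1"
  shows "(\<forall>i j. extremal_betti (frobenius_power (p ^ e) I) i j \<longrightarrow>
            (\<exists>l. j = p ^ e * l \<and> extremal_betti I i l)) \<and>
         (\<forall>i j. extremal_betti I i j \<longrightarrow>
            extremal_betti (frobenius_power (p ^ e) I) i (p ^ e * j))"
proof -
  define q where "q = p ^ e"
  have q: "0 < q"
    using assms(2) by (simp add: q_def)
  note nz = graded_betti_frobenius_power[OF assms(1-3) q_def]
  have nz_mult: "graded_betti (frobenius_power q I) i (q * l) \<noteq> 0 \<longleftrightarrow> graded_betti I i l \<noteq> 0" for i l
    unfolding nz using q by auto
  \<comment> \<open>The map from \<open>(k, m)\<close> to \<open>(k, q * m)\<close> preserves and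
    reflects the order of bidegrees and is injective since \<open>q > 0\<close>. It carries the
    nonzero positions for \<open>I\<close> exactly onto those for the Frobenius power, so it matches
    the extremal ones.\<close>
  have "extremal_betti (frobenius_power (q) I) i (q * l) \<longleftrightarrow> extremal_betti I i l" for i l
  proof
    assume ext: "extremal_betti (frobenius_power (q) I) i (q * l)"
    show "extremal_betti I i l"
      unfolding extremal_betti_def
    proof (intro conjI allI impI)
      show "graded_betti I i l \<noteq> 0"
        using ext unfolding extremal_betti_def nz_mult by blast
      fix k m assume "(k, m) \<noteq> (i, l) \<and> i \<le> k \<and> l \<le> m"
      then have "graded_betti (frobenius_power (q) I) k (q * m) = 0"
        using ext q by (auto simp: extremal_betti_def)
      then show "graded_betti I k m = 0"
        using nz_mult by blast
    qed
  next
    assume ext: "extremal_betti I i l"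
    show "extremal_betti (frobenius_power (q) I) i (q * l)"
      unfolding extremal_betti_def
    proof (intro conjI allI impI)
      show "graded_betti (frobenius_power (q) I) i (q * l) \<noteq> 0"
        using ext unfolding extremal_betti_def nz_mult by blast
      fix k j assume kj: "(k, j) \<noteq> (i, q * l) \<and> i \<le> k \<and> q * l \<le> j"
      show "graded_betti (frobenius_power (q) I) k j = 0"
      proof (rule ccontr)
        assume "graded_betti (frobenius_power (q) I) k j \<noteq> 0"
        \<comment> \<open>A nonzero Betti number outside the image of the rescaling is impossible,
          so \<open>j\<close> has the form \<open>q * m\<close> and the comparison with
          \<open>q * l\<close> reduces to that of \<open>m\<close> with \<open>l\<close>.\<close>
        then obtain m where "j = q * m" "graded_betti I k m \<noteq> 0"
          using nz by blast
        with kj ext q show False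
          by (auto simp: extremal_betti_def)
      qed
    qed
  qed
  moreover have "\<exists>l. j = q * l" if "extremal_betti (frobenius_power (q) I) i j" for i j
    using that nz unfolding extremal_betti_def by blast
  ultimately show ?thesis
    unfolding q_def by blast
qed

end
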